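(* Let $k,m,s,t$ be positive integers. (i) If $k$ is even, then $R((k-1)K_2,P_k,P_k)=3k-4$. (ii) If $s<m-1<2s+1$ and $t\ge m+s-1$, then $R(tK_2,P_{2s+1},P_{2m})=s+m+2t-2$.
   Context: All graphs are finite, simple and undirected. $P_n$ denotes the path on $n$ vertices and $tK_2$ the disjoint union of $t$ edges (a matching of size $t$). For graphs $G_1,\ldots,G_k$, the multicolor Ramsey number $R(G_1,\ldots,G_k)$ is the smallest integer $n$ such that every coloring of the edges of the complete graph $K_n$ with $k$ colors contains a monochromatic copy of $G_i$ in color $i$ for some $1\le i\le k$ (a copy means a not necessarily induced subgraph). *)

theory Defs
  imports "HOL-Library.Ramsey"
begin

text \<open>Finite simple undirected graphs as pairs of a vertex set and a set of two-element
  vertex sets; \<open>[V]\<^bsup>2\<^esup>\<close> is the set of two-element subsets of \<open>V\<close>.\<close>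

type_synonym 'a ugraph = "'a set \<times> 'a set set"

abbreviation verts :: "'a ugraph \<Rightarrow> 'a set" where
  "verts G \<equiv> fst G"

abbreviation edges :: "'a ugraph \<Rightarrow> 'a set set" where
  "edges G \<equiv> snd G"

definition simple_graph :: "'a ugraph \<Rightarrow> bool" where
  "simple_graph G \<longleftrightarrow> finite (verts G) \<and> edges G \<subseteq> [verts G]\<^bsup>2\<^esup>"

definition complete_graph :: "nat \<Rightarrow> nat ugraph" where
  "complete_graph n = ({..<n}, [{..<n}]\<^bsup>2\<^esup>)"

definition path_graph :: "nat \<Rightarrow> nat ugraph" where
  "path_graph n = ({..<n}, {{i, Suc i} |i. Suc i < n})"

definition matching_graph :: "nat \<Rightarrow> nat ugraph" where
  "matching_graph t = ({..<2 * t}, {{2 * i, 2 * i + 1} |i. i < t})"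

lemma simple_complete_graph: "simple_graph (complete_graph n)"
  by (simp add: simple_graph_def complete_graph_def)

lemma simple_path_graph: "simple_graph (path_graph n)"
  by (auto simp: simple_graph_def path_graph_def nsets_def)

lemma simple_matching_graph: "simple_graph (matching_graph t)"
  by (auto simp: simple_graph_def matching_graph_def nsets_def)

text \<open>A copy of \<open>G\<close> in \<open>H\<close> is a not necessarily induced subgraph of \<open>H\<close> isomorphic to \<open>G\<close>.\<close>

definition contains_copy :: "'b ugraph \<Rightarrow> 'a ugraph \<Rightarrow> bool" where
  "contains_copy H G \<longleftrightarrow>
     (\<exists>\<phi>. inj_on \<phi> (verts G) \<and> \<phi> ` verts G \<subseteq> verts H \<and> (\<forall>e\<in>edges G. \<phi> ` e \<in> edges H))"

definition colour_class :: "'a ugraph \<Rightarrow> ('a set \<Rightarrow> nat) \<Rightarrow> nat \<Rightarrow> 'a ugraph" where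
  "colour_class H c i = (verts H, {e \<in> edges H. c e = i})"

text \<open>Colours are numbered from 0, so that the graph \<open>Gs ! i\<close> is sought in colour \<open>i\<close>.\<close>

definition ramsey_number :: "'a ugraph list \<Rightarrow> nat" where
  "ramsey_number Gs =
     (LEAST n. \<forall>c \<in> edges (complete_graph n) \<rightarrow> {..<length Gs}.
        \<exists>i<length Gs. contains_copy (colour_class (complete_graph n) c i) (Gs ! i))"

end

theory Submission
  imports Defs "HOL-Library.Disjoint_Sets"
begin

text \<open>Both parts are instances of one statement. Put \<open>a = s + m - 1\<close> and let \<open>t \<ge> a\<close>. Then
\<open>R(tK\<^sub>2, P\<^sub>l, P\<^sub>2\<^sub>m) = 2t + a - 1\<close>, with \<open>l = 2s\<close> for arbitrary \<open>s\<close> and \<open>m\<close>, and also with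
\<open>l = 2s + 1\<close> as soon as \<open>s < m - 1\<close>. Part (i) is the case \<open>2s = 2m = k\<close>, \<open>t = k - 1 = a\<close>.

The lower bound comes from vertex covers. Take \<open>s - 1\<close> vertices, \<open>m - 1\<close> vertices and \<open>2t - 1\<close>
vertices; give colour 1 to the edges that touch the first group, colour 2 to the other edges that
touch the second group, and colour 0 to the rest. A path on at least \<open>2s\<close> vertices has \<open>s\<close>
disjoint edges and is not covered by \<open>s - 1\<close> vertices.

For the upper bound suppose that colour 0 has no matching of size \<open>t\<close>. The Tutte-Berge theorem
(\<open>tutte_berge_bound\<close>) yields a small set \<open>S\<close> such that the colour 0 edges avoiding \<open>S\<close> stay inside
the parts of a partition of the remaining vertices, and these parts are so small or so many that
they can be distributed on two sides with at least \<open>a\<close> vertices each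
(\<open>no_matching_imp_empty_bipartite\<close>). Between the two sides there is no edge of colour 0, which
leaves a complete bipartite graph with sides of size \<open>a\<close> whose edges have colour 1 or 2.

The heart of the proof is the path-path Ramsey theorem for this bipartite graph
(\<open>even_even_paths\<close> and \<open>odd_even_paths\<close>). Choose disjoint paths \<open>P\<close> of one colour and \<open>Q\<close> of the
other that together cover as many vertices as possible. If they miss at most one vertex, then
\<open>|P| + |Q|\<close> is about \<open>2a = 2s + 2m - 2\<close>, so both lengths fall short of the desired ones by at most
three vertices if neither reaches its goal, and the edges at the ends of the two paths supply the
missing vertices for one of them. If they miss two or more vertices, the pair is stuck: exchange
arguments show that all four ends lie on the same side, say \<open>Y\<close>, that \<open>P\<close> and the second vertex of
\<open>Q\<close> form a cycle, and that an uncovered vertex \<open>v\<close> of \<open>X\<close> sees \<open>P\<close> only in the colour of \<open>Q\<close>. If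
moreover \<open>P\<close> is as long as possible, \<open>P\<close> contains \<^emph>\<open>every\<close> neighbour of \<open>v\<close> in the colour of \<open>Q\<close>
(\<open>stuck_degree_cycle\<close>). Hence each colour has a cycle on twice as many vertices as \<open>v\<close> has
neighbours in the opposite colour. The two degrees of \<open>v\<close> add up to \<open>a = s + m - 1\<close>. For \<open>l = 2s\<close>
this makes one of the two cycles long enough. For \<open>l = 2s + 1\<close> it may narrowly fail in both
colours at once; then the edges between one cycle and the neighbours of \<open>v\<close> outside it decide.\<close>

section \<open>The Tutte-Berge bound\<close>

lemma partition_on_eqI:
  assumes "partition_on W \<P>" "A \<in> \<P>" "B \<in> \<P>" "x \<in> A" "x \<in> B"
  shows "A = B"
  using assms by (metis IntI disjointD empty_iff partition_onD2)

definition matching :: "'a set set \<Rightarrow> 'a set set \<Rightarrow> bool" where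
  "matching E M \<longleftrightarrow> M \<subseteq> E \<and> (\<forall>e\<in>M. \<forall>f\<in>M. e \<noteq> f \<longrightarrow> e \<inter> f = {})"

definition max_matching :: "'a set set \<Rightarrow> 'a set set \<Rightarrow> bool" where
  "max_matching E M \<longleftrightarrow> matching E M \<and> (\<forall>N. matching E N \<longrightarrow> card N \<le> card M)"

lemma max_matching_exists:
  assumes "finite E"
  shows "\<exists>M. max_matching E M"
proof -
  have "matching E {}" by (simp add: matching_def)
  moreover have "\<forall>N. matching E N \<longrightarrow> card N < Suc (card E)"
    using assms by (simp add: matching_def card_mono less_Suc_eq_le)
  ultimately show ?thesis
    unfolding max_matching_def by (rule ex_has_greatest_nat)
qed

lemma card_Union_matching:
  assumes "matching E M" "E \<subseteq> [V]\<^bsup>2\<^esup>" "finite V"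
  shows "finite M" "finite (\<Union>M)" "card (\<Union>M) = 2 * card M"
proof -
  have "M \<subseteq> Pow V" using assms by (auto simp: matching_def nsets_def)
  thus fin: "finite M" using assms(3) finite_subset by fastforce
  have two: "finite e \<and> card e = 2" if "e \<in> M" for e
    using that assms by (auto simp: matching_def nsets_def)
  thus "finite (\<Union>M)" using fin by auto
  have "card (\<Union>M) = (\<Sum>e\<in>M. card e)"
    by (rule card_Union_disjoint)
       (use assms two in \<open>auto simp: matching_def pairwise_def disjnt_def\<close>)
  also have "\<dots> = 2 * card M" using two by simp
  finally show "card (\<Union>M) = 2 * card M" .
qed

text \<open>This is Gallai's lemma in disguise: the relation that no maximum matching misses both of
two vertices is transitive. If \<open>M\<close> misses \<open>u\<close> and \<open>v\<close>, whereas \<open>N\<close> misses \<open>t\<close> and hence covers \<open>u\<close>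
and \<open>v\<close>, then some edge of \<open>M\<close> at a vertex other than \<open>t\<close> that \<open>N\<close> misses can be exchanged for an
edge of \<open>N\<close>. This brings \<open>N\<close> closer to \<open>M\<close> and still misses \<open>t\<close>, so the induction is on the number
of edges of \<open>M\<close> outside \<open>N\<close>.\<close>

lemma max_matching_exchange:
  assumes V: "finite V" "E \<subseteq> [V]\<^bsup>2\<^esup>"
    and M: "max_matching E M" "u \<notin> \<Union>M" "v \<notin> \<Union>M" "u \<noteq> v"
    and ut: "\<And>N. max_matching E N \<Longrightarrow> t \<notin> \<Union>N \<Longrightarrow> u \<in> \<Union>N"
    and tv: "\<And>N. max_matching E N \<Longrightarrow> t \<notin> \<Union>N \<Longrightarrow> v \<in> \<Union>N"
    and N: "max_matching E N" "t \<notin> \<Union>N"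
  shows False
  using N
proof (induction "card (M - N)" arbitrary: N rule: less_induct)
  case less
  have mM: "matching E M" and mN: "matching E N"
    using M(1) less.prems(1) by (auto simp: max_matching_def)
  note cM = card_Union_matching[OF mM V(2,1)] and cN = card_Union_matching[OF mN V(2,1)]
  have "card M = card N"
    using M(1) less.prems(1) by (auto simp: max_matching_def intro: le_antisym)
  hence eq: "card (\<Union>M) = card (\<Union>N)" using cM cN by simp
  have "{u, v} \<subseteq> \<Union>N - \<Union>M" using ut tv M less.prems by blast
  hence "card {u, v} \<le> card (\<Union>N - \<Union>M)" using cN(2) by (intro card_mono) auto
  hence "2 \<le> card (\<Union>N - \<Union>M)" using M(4) by simp
  moreover have "card (\<Union>N - \<Union>M) = card (\<Union>M - \<Union>N)"
    using eq cM(2) cN(2) card_Diff_subset_Int[of "\<Union>N" "\<Union>M"] card_Diff_subset_Int[of "\<Union>M" "\<Union>N"]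
    by (simp add: Int_commute)
  ultimately have "\<not> \<Union>M - \<Union>N \<subseteq> {t}"
    using card_mono[of "{t}" "\<Union>M - \<Union>N"] by auto
  then obtain x e where x: "x \<in> e" "e \<in> M" "x \<notin> \<Union>N" "x \<noteq> t" by blast
  have "card e = 2" using x(2) mM V(2) by (auto simp: matching_def nsets_def)
  then obtain y where e: "e = {x, y}" "x \<noteq> y" using x(1) by (auto simp: card_2_iff)
  have eN: "e \<notin> N" and eE: "e \<in> E" using x mM by (auto simp: matching_def)
  have "y \<in> \<Union>N"
  proof (rule ccontr)
    assume "y \<notin> \<Union>N"
    hence "matching E (insert e N)" using mN x e eE by (auto simp: matching_def)
    hence "card (insert e N) \<le> card N" using less.prems by (auto simp: max_matching_def)
    thus False using eN cN(1) by simp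
  qed
  then obtain f where f: "f \<in> N" "y \<in> f" by blast
  have "f \<noteq> e" "f \<inter> e \<noteq> {}" using x f e by auto
  hence fM: "f \<notin> M" using mM x(2) unfolding matching_def by blast
  let ?N = "insert e (N - {f})"
  have "matching E ?N" using mN x e eE f unfolding matching_def by blast
  moreover have "card ?N = card N"
    using cN(1) eN f by (metis Diff_iff card_Suc_Diff1 card_insert_disjoint finite_Diff)
  ultimately have "max_matching E ?N" using less.prems(1) by (auto simp: max_matching_def)
  moreover have "t \<notin> \<Union>?N" using less.prems(2) x e f by auto
  moreover have "card (M - ?N) < card (M - N)"
    by (rule psubset_card_mono) (use cM(1) fM x eN in auto)
  ultimately show False using less.hyps by blast
qed

text \<open>Induction on the number of vertices. A vertex that every maximum matching covers is moved
to \<open>S\<close>: its deletion lowers the matching number. If there is no such vertex, \<open>S\<close> is empty and the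
parts are the classes of the equivalence relation of the previous lemma. Adjacent vertices are
equivalent, since an edge missed at both ends would enlarge the matching, and a maximum matching
misses at most one vertex of each class, so it contains half of each class, rounded down.\<close>

theorem tutte_berge_bound:
  fixes V :: "'a set"
  assumes "finite V" "E \<subseteq> [V]\<^bsup>2\<^esup>"
  shows "\<exists>S \<P> M. S \<subseteq> V \<and> partition_on (V - S) \<P> \<and>
           (\<forall>e\<in>E. e \<inter> S = {} \<longrightarrow> (\<exists>A\<in>\<P>. e \<subseteq> A)) \<and>
           matching E M \<and> card S + (\<Sum>A\<in>\<P>. card A div 2) \<le> card M"
  using assms
proof (induction "card V" arbitrary: V E rule: less_induct)
  case less
  have finE: "finite E" using less.prems finite_imp_finite_nsets finite_subset by blast
  show ?case
  proof (cases "\<exists>v\<in>V. \<forall>M. max_matching E M \<longrightarrow> v \<in> \<Union>M")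
    case True
    then obtain v where v: "v \<in> V" "\<And>M. max_matching E M \<Longrightarrow> v \<in> \<Union>M" by blast
    define E' where "E' = {e \<in> E. v \<notin> e}"
    have "E' \<subseteq> [V - {v}]\<^bsup>2\<^esup>" using less.prems by (auto simp: E'_def nsets_def)
    moreover have "card (V - {v}) < card V"
      using v less.prems by (intro psubset_card_mono) auto
    ultimately obtain S \<P> M where *: "S \<subseteq> V - {v}" "partition_on (V - {v} - S) \<P>"
        "\<forall>e\<in>E'. e \<inter> S = {} \<longrightarrow> (\<exists>A\<in>\<P>. e \<subseteq> A)"
        "matching E' M" "card S + (\<Sum>A\<in>\<P>. card A div 2) \<le> card M"
      using less.hyps[of "V - {v}" E'] less.prems by auto
    obtain N where N: "max_matching E N" using max_matching_exists[OF finE] by blast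
    have "matching E M" "v \<notin> \<Union>M" using *(4) by (auto simp: matching_def E'_def)
    hence "card M < card N"
      using N v(2) unfolding max_matching_def by (metis le_neq_implies_less)
    moreover have "card (insert v S) = Suc (card S)"
    proof -
      have "finite S" using *(1) less.prems(1) by (auto intro: finite_subset)
      moreover have "v \<notin> S" using *(1) by blast
      ultimately show ?thesis by simp
    qed
    ultimately have "card (insert v S) + (\<Sum>A\<in>\<P>. card A div 2) \<le> card N" using * by simp
    moreover have "partition_on (V - insert v S) \<P>"
      using *(2) by (metis Diff_insert Diff_insert2)
    moreover have "\<forall>e\<in>E. e \<inter> insert v S = {} \<longrightarrow> (\<exists>A\<in>\<P>. e \<subseteq> A)"
      using *(3) by (auto simp: E'_def)
    moreover have "insert v S \<subseteq> V" using v *(1) by auto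
    ultimately show ?thesis using N unfolding max_matching_def by blast
  next
    case False
    define r where "r = {(u, v). u \<in> V \<and> v \<in> V \<and>
      (u = v \<or> (\<forall>M. max_matching E M \<longrightarrow> u \<in> \<Union>M \<or> v \<in> \<Union>M))}"
    have "trans r"
    proof (rule transI)
      fix u t v assume uv: "(u, t) \<in> r" "(t, v) \<in> r"
      show "(u, v) \<in> r"
      proof (rule ccontr)
        assume "(u, v) \<notin> r"
        then obtain M where M: "max_matching E M" "u \<notin> \<Union>M" "v \<notin> \<Union>M" "u \<noteq> v"
          using uv by (auto simp: r_def)
        have "u \<noteq> t" "t \<noteq> v" using uv M \<open>(u, v) \<notin> r\<close> by auto
        note M this
        moreover obtain N where "max_matching E N" "t \<notin> \<Union>N"
          using False uv by (auto simp: r_def)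
        ultimately show False
          using uv by (intro max_matching_exchange[OF less.prems, of M u v t N]) (auto simp: r_def)
      qed
    qed
    hence eqv: "equiv V r"
      by (intro equivI) (auto simp: r_def refl_on_def sym_def)
    let ?P = "V // r"
    have part: "partition_on V ?P" by (rule partition_on_quotient[OF eqv])
    have inside: "\<exists>A\<in>?P. e \<subseteq> A" if e: "e \<in> E" for e
    proof -
      have "card e = 2" "e \<subseteq> V" using e less.prems by (auto simp: nsets_def)
      then obtain x y where xy: "e = {x, y}" "x \<noteq> y" by (auto simp: card_2_iff)
      have "x \<in> \<Union>M \<or> y \<in> \<Union>M" if M: "max_matching E M" for M
      proof (rule ccontr)
        assume "\<not> ?thesis"
        hence "matching E (insert e M)" "e \<notin> M"
          using M e xy by (auto simp: max_matching_def matching_def)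
        moreover have "finite M" using M finE
          by (auto simp: max_matching_def matching_def intro: finite_subset)
        ultimately show False using M by (fastforce simp: max_matching_def)
      qed
      hence "e \<subseteq> r `` {x}" using xy \<open>e \<subseteq> V\<close> by (auto simp: r_def)
      thus ?thesis using xy \<open>e \<subseteq> V\<close> by (auto intro: quotientI)
    qed
    obtain M where M: "max_matching E M" using max_matching_exists[OF finE] by blast
    hence mM: "matching E M" by (simp add: max_matching_def)
    have finM: "finite M" using mM finE by (auto simp: matching_def intro: finite_subset)
    have finP: "finite ?P" using less.prems(1) eqv
      by (meson equiv_type finite_quotient)
    have half: "card A div 2 \<le> card {e \<in> M. e \<subseteq> A}" if A: "A \<in> ?P" for A
    proof -
      let ?M = "{e \<in> M. e \<subseteq> A}"
      have AV: "A \<subseteq> V" using A part by (auto simp: partition_on_def)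
      have mm: "matching E ?M" using mM by (auto simp: matching_def)
      note c = card_Union_matching[OF mm less.prems(2,1)]
      have "\<Union>?M = A \<inter> \<Union>M"
      proof
        show "A \<inter> \<Union>M \<subseteq> \<Union>?M"
        proof
          fix x assume x: "x \<in> A \<inter> \<Union>M"
          then obtain e where e: "x \<in> e" "e \<in> M" by blast
          have "e \<in> E" using e mM by (auto simp: matching_def)
          then obtain A' where A': "A' \<in> ?P" "e \<subseteq> A'" using inside by blast
          hence "A' = A" using partition_on_eqI[OF part, of A' A x] A x e by blast
          thus "x \<in> \<Union>?M" using A' e by blast
        qed
      qed blast
      moreover have "card (A - \<Union>M) \<le> 1"
      proof -
        have "x = y" if xy: "x \<in> A - \<Union>M" "y \<in> A - \<Union>M" for x y
        proof -
          have "(x, y) \<in> r" using xy A eqv quotient_eq_iff[OF eqv A A] by auto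
          thus ?thesis using xy M by (auto simp: r_def)
        qed
        moreover have "finite (A - \<Union>M)" using AV less.prems(1) by (auto intro: finite_subset)
        ultimately show ?thesis by (auto simp: card_le_Suc0_iff_eq)
      qed
      moreover have "card A = card (A \<inter> \<Union>M) + card (A - \<Union>M)"
        using AV less.prems(1) by (metis card_Int_Diff finite_subset)
      ultimately have "card A \<le> 2 * card ?M + 1" using c(3) by simp
      thus ?thesis by simp
    qed
    have "(\<Sum>A\<in>?P. card A div 2) \<le> (\<Sum>A\<in>?P. card {e \<in> M. e \<subseteq> A})"
      by (rule sum_mono) (rule half)
    also have "\<dots> = card (\<Union>A\<in>?P. {e \<in> M. e \<subseteq> A})"
    proof (rule card_UN_disjoint[symmetric])
      show "\<forall>A\<in>?P. \<forall>B\<in>?P. A \<noteq> B \<longrightarrow> {e \<in> M. e \<subseteq> A} \<inter> {e \<in> M. e \<subseteq> B} = {}"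
      proof (intro ballI impI)
        fix A B assume "A \<in> ?P" "B \<in> ?P" "A \<noteq> B"
        hence "A \<inter> B = {}" using part by (auto simp: partition_on_def disjoint_def)
        moreover have "e \<noteq> {}" if "e \<in> M" for e
          using that mM less.prems by (auto simp: matching_def nsets_def)
        ultimately show "{e \<in> M. e \<subseteq> A} \<inter> {e \<in> M. e \<subseteq> B} = {}" by blast
      qed
    qed (use finP finM in auto)
    also have "\<dots> \<le> card M" by (rule card_mono) (use finM in auto)
    finally have "card {} + (\<Sum>A\<in>?P. card A div 2) \<le> card M" by simp
    moreover have "\<forall>e\<in>E. e \<inter> {} = {} \<longrightarrow> (\<exists>A\<in>?P. e \<subseteq> A)" using inside by blast
    moreover have "partition_on (V - {}) ?P" using part by simp
    ultimately show ?thesis using mM by (intro exI[of _ "{}"] exI[of _ ?P] exI[of _ M]) auto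
  qed
qed

section \<open>Edgeless pairs in graphs without a large matching\<close>

text \<open>Let \<open>W\<close> be the complement of \<open>S\<close> and \<open>p\<close> the sum of the halved part sizes. The bound on the
matching gives \<open>|W| \<ge> 2a + p\<close>. A part with at least \<open>a\<close> vertices can form one side by itself.
Otherwise all parts except possibly a largest one have at most \<open>p + 1\<close> vertices, so adding parts
one by one to a largest part cannot jump over the interval from \<open>a\<close> to \<open>a + p\<close>.\<close>

lemma no_matching_imp_empty_bipartite:
  fixes V :: "'a set"
  assumes V: "finite V" "E \<subseteq> [V]\<^bsup>2\<^esup>"
    and no: "\<And>M. matching E M \<Longrightarrow> card M < t"
    and n: "2 * t + a \<le> Suc (card V)" and at: "a \<le> t"
  shows "\<exists>A B. A \<subseteq> V \<and> B \<subseteq> V \<and> A \<inter> B = {} \<and> card A = a \<and> card B = a \<and>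
           (\<forall>x\<in>A. \<forall>y\<in>B. {x, y} \<notin> E)"
proof (cases "a = 0")
  case True
  thus ?thesis by (intro exI[of _ "{}"]) auto
next
  case a: False
  obtain S \<P> M where SP: "S \<subseteq> V" "partition_on (V - S) \<P>"
      "\<forall>e\<in>E. e \<inter> S = {} \<longrightarrow> (\<exists>A\<in>\<P>. e \<subseteq> A)"
      "matching E M" "card S + (\<Sum>A\<in>\<P>. card A div 2) \<le> card M"
    using tutte_berge_bound[OF V] by blast
  define W where "W = V - S"
  define p where "p = (\<Sum>A\<in>\<P>. card A div 2)"
  have finW: "finite W" using V by (simp add: W_def)
  have part: "partition_on W \<P>" using SP by (simp add: W_def)
  have finP: "finite \<P>" using part finW finite_elements by blast
  have fin: "finite A" if "A \<in> \<P>" for A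
    using that part finW by (metis Sup_upper partition_onD1 finite_subset)
  have cardU: "card (\<Union>F) = (\<Sum>A\<in>F. card A)" if "F \<subseteq> \<P>" for F
  proof (rule card_Union_disjoint)
    show "pairwise disjnt F"
      using that partition_onD2[OF part] unfolding disjoint_def pairwise_def disjnt_def by blast
  qed (use that fin in blast)
  have W: "\<Union>\<P> = W" using part by (simp add: partition_on_def)
  have Sp: "card S + p < t" using SP(5) no[OF SP(4)] by (simp add: p_def)
  have cW: "card W + card S = card V"
    using SP(1) V(1) unfolding W_def by (metis card_Diff_subset card_mono finite_subset le_add_diff_inverse2)
  have N: "2 * a + p \<le> card W" using Sp cW n at by linarith
  have two_parts: "card A div 2 + card B div 2 \<le> p" if "A \<in> \<P>" "B \<in> \<P>" "A \<noteq> B" for A B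
  proof -
    have "(\<Sum>A\<in>{A, B}. card A div 2) \<le> p"
      unfolding p_def by (rule sum_mono2) (use that finP in auto)
    thus ?thesis using that by simp
  qed
  have "\<exists>F. F \<subseteq> \<P> \<and> a \<le> card (\<Union>F) \<and> card (\<Union>F) + a \<le> card W"
  proof (cases "\<exists>L\<in>\<P>. a \<le> card L")
    case True
    then obtain L where L: "L \<in> \<P>" "a \<le> card L" by blast
    have "card L div 2 \<le> p" unfolding p_def using L finP by (intro member_le_sum) auto
    hence "card L + a \<le> card W" using Sp cW n by linarith
    thus ?thesis using L by (intro exI[of _ "{L}"]) auto
  next
    case False
    have "\<P> \<noteq> {}" using W N a by auto
    hence "Max (card ` \<P>) \<in> card ` \<P>" using finP by (intro Max_in) auto
    then obtain L where "L \<in> \<P>" "card L = Max (card ` \<P>)" by auto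
    hence L: "L \<in> \<P>" "\<And>A. A \<in> \<P> \<Longrightarrow> card A \<le> card L" using finP by auto
    let ?Q = "\<lambda>F. F \<subseteq> \<P> \<and> L \<in> F \<and> card (\<Union>F) + a \<le> card W"
    have "?Q {L}" using L False N by force
    moreover have "\<forall>F. ?Q F \<longrightarrow> card (\<Union>F) < Suc (card W)" by auto
    ultimately have "\<exists>F. ?Q F \<and> (\<forall>F'. ?Q F' \<longrightarrow> card (\<Union>F') \<le> card (\<Union>F))"
      by (rule ex_has_greatest_nat)
    then obtain F where F: "?Q F" "\<And>F'. ?Q F' \<Longrightarrow> card (\<Union>F') \<le> card (\<Union>F)" by blast
    \<comment> \<open>A maximal family that leaves \<open>a\<close> vertices cannot be extended, although a further part is small.\<close>
    have "a \<le> card (\<Union>F)"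
    proof (rule ccontr)
      assume less: "\<not> ?thesis"
      have "F \<noteq> \<P>" using less W N by auto
      then obtain A where A: "A \<in> \<P>" "A \<notin> F" using F by blast
      have "card A div 2 + card L div 2 \<le> p" "card A \<le> card L"
        using two_parts A F L by blast+
      hence "card A \<le> p + 1" by linarith
      moreover have "card (\<Union>(insert A F)) = card A + card (\<Union>F)"
        using A F cardU[of "insert A F"] cardU[of F] finite_subset[OF _ finP] by (subst cardU) auto
      ultimately have "?Q (insert A F)" using A F less N by auto
      hence "card (\<Union>(insert A F)) \<le> card (\<Union>F)" using F by blast
      moreover have "card A > 0" using A part fin by (auto simp: partition_on_def card_gt_0_iff)
      ultimately show False using \<open>card (\<Union>(insert A F)) = _\<close> by simp
    qed
    thus ?thesis using F by blast
  qed
  then obtain F where F: "F \<subseteq> \<P>" "a \<le> card (\<Union>F)" "card (\<Union>F) + a \<le> card W" by blast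
  have FW: "\<Union>F \<subseteq> W" using F W by blast
  have "a \<le> card (W - \<Union>F)" using F FW finW by (simp add: card_Diff_subset finite_subset)
  then obtain A B where AB: "A \<subseteq> \<Union>F" "card A = a" "B \<subseteq> W - \<Union>F" "card B = a"
    using F(2) by (meson obtain_subset_with_card_n)
  have "{x, y} \<notin> E" if xy: "x \<in> A" "y \<in> B" for x y
  proof
    assume "{x, y} \<in> E"
    moreover have "{x, y} \<inter> S = {}" using xy AB FW by (auto simp: W_def)
    ultimately obtain D where D: "D \<in> \<P>" "{x, y} \<subseteq> D" using SP by blast
    obtain D' where D': "D' \<in> F" "x \<in> D'" using xy AB by blast
    hence "D' = D" using partition_on_eqI[OF part, of D' D x] D F by blast
    thus False using D D' xy AB by blast
  qed
  moreover have "A \<subseteq> V" "B \<subseteq> V" "A \<inter> B = {}" using AB FW by (auto simp: W_def)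
  ultimately show ?thesis using AB by blast
qed

section \<open>Monochromatic paths in two-coloured complete bipartite graphs\<close>

text \<open>The two colours are truth values, so that swapping the colours is negation, and only the
values of \<open>C\<close> between \<open>X\<close> and \<open>Y\<close> matter.\<close>

locale bicoloured =
  fixes X Y :: "'a set" and C :: "'a \<Rightarrow> 'a \<Rightarrow> bool"
  assumes fin: "finite X" "finite Y" and disj: "X \<inter> Y = {}"
    and balanced: "card X = card Y" and C_sym: "C x y = C y x"
begin

definition adj :: "bool \<Rightarrow> 'a \<Rightarrow> 'a \<Rightarrow> bool" where
  "adj b x y \<longleftrightarrow> (x \<in> X \<and> y \<in> Y \<or> x \<in> Y \<and> y \<in> X) \<and> C x y = b"

definition mono_path :: "bool \<Rightarrow> 'a list \<Rightarrow> bool" where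
  "mono_path b xs \<longleftrightarrow> distinct xs \<and> set xs \<subseteq> X \<union> Y \<and> successively (adj b) xs"

text \<open>With sides as signs, counting how often a path visits \<open>X\<close> and \<open>Y\<close> becomes linear arithmetic
in the signs of its ends.\<close>

definition side :: "'a \<Rightarrow> int" where
  "side x = (if x \<in> Y then 1 else - 1)"

lemma adj_sym: "adj b x y \<longleftrightarrow> adj b y x"
  using C_sym by (auto simp: adj_def)

lemma adj_cross:
  "x \<in> X \<Longrightarrow> y \<in> Y \<Longrightarrow> adj b x y \<or> adj (\<not> b) x y"
  "x \<in> X \<Longrightarrow> y \<in> Y \<Longrightarrow> adj b y x \<or> adj (\<not> b) y x"
  by (auto simp: adj_def)

lemma adj_side: "adj b x y \<Longrightarrow> x \<in> Y \<longleftrightarrow> y \<in> X" "adj b x y \<Longrightarrow> x \<in> X \<longleftrightarrow> y \<in> Y"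
  using disj by (auto simp: adj_def)

lemma mono_path_Nil [simp]: "mono_path b []"
  by (simp add: mono_path_def)

lemma mono_path_Cons [simp]:
  "mono_path b (x # xs) \<longleftrightarrow>
     x \<in> X \<union> Y \<and> x \<notin> set xs \<and> mono_path b xs \<and> (xs \<noteq> [] \<longrightarrow> adj b x (hd xs))"
  by (cases xs) (auto simp: mono_path_def)

lemma mono_path_append:
  "mono_path b (xs @ ys) \<longleftrightarrow> mono_path b xs \<and> mono_path b ys \<and> set xs \<inter> set ys = {} \<and>
     (xs \<noteq> [] \<and> ys \<noteq> [] \<longrightarrow> adj b (last xs) (hd ys))"
  by (auto simp: mono_path_def successively_append_iff)

lemma mono_path_rev [simp]: "mono_path b (rev xs) \<longleftrightarrow> mono_path b xs"
  using adj_sym[of b] by (auto simp: mono_path_def successively_rev)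

lemma mono_path_take: "mono_path b xs \<Longrightarrow> mono_path b (take n xs)"
  by (metis append_take_drop_id mono_path_append)

lemma mono_path_subset: "mono_path b xs \<Longrightarrow> set xs \<subseteq> X \<union> Y"
  by (simp add: mono_path_def)

lemma mono_path_length: "mono_path b xs \<Longrightarrow> length xs = card (set xs)"
  by (simp add: mono_path_def distinct_card)

text \<open>Along a path the signs alternate, so their sum telescopes to the half-sum of the signs of
the ends.\<close>

lemma mono_path_balance:
  assumes "mono_path b xs" "xs \<noteq> []"
  shows "2 * (int (card (set xs \<inter> Y)) - int (card (set xs \<inter> X))) = side (hd xs) + side (last xs)"
  using assms
proof (induction xs)
  case (Cons x xs)
  have x: "x \<in> X \<union> Y" "x \<notin> set xs" using Cons.prems by auto
  have step: "int (card (set (x # xs) \<inter> Y)) - int (card (set (x # xs) \<inter> X)) =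
      side x + (int (card (set xs \<inter> Y)) - int (card (set xs \<inter> X)))"
    using x disj by (auto simp: side_def Int_insert_left)
  show ?case
  proof (cases "xs = []")
    case True
    thus ?thesis using step by simp
  next
    case False
    hence "adj b x (hd xs)" using Cons.prems by simp
    hence "side x + side (hd xs) = 0" using disj by (auto simp: side_def adj_def)
    thus ?thesis using step Cons False by simp
  qed
qed simp

lemma mono_path_length_sides:
  assumes "mono_path b xs"
  shows "length xs = card (set xs \<inter> X) + card (set xs \<inter> Y)"
proof -
  have "set xs = (set xs \<inter> X) \<union> (set xs \<inter> Y)" using mono_path_subset[OF assms] by blast
  moreover have "card ((set xs \<inter> X) \<union> (set xs \<inter> Y)) = card (set xs \<inter> X) + card (set xs \<inter> Y)"
    using disj by (intro card_Un_disjoint) auto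
  ultimately show ?thesis using mono_path_length[OF assms] by simp
qed

lemma mono_path_closed_rotate:
  assumes "mono_path b xs" "adj b (last xs) (hd xs)" "y \<in> set xs"
  obtains ys where "mono_path b ys" "set ys = set xs" "hd ys = y" "ys \<noteq> []" "length ys = length xs"
    "adj b (last ys) (hd ys)"
proof -
  obtain us vs where xs: "xs = us @ y # vs" using assms(3) by (meson split_list)
  show thesis
  proof (cases "us = []")
    case True
    thus thesis using that[of xs] assms xs by auto
  next
    case False
    show thesis
      by (rule that[of "y # vs @ us"])
         (use False assms xs in \<open>auto simp: mono_path_append last_append hd_append split: if_splits\<close>)
  qed
qed

section \<open>Maximal pairs of disjoint paths\<close>

definition path_pair :: "bool \<Rightarrow> 'a list \<Rightarrow> 'a list \<Rightarrow> bool" where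
  "path_pair b P Q \<longleftrightarrow> mono_path b P \<and> mono_path (\<not> b) Q \<and> set P \<inter> set Q = {}"

definition max_pair :: "bool \<Rightarrow> 'a list \<Rightarrow> 'a list \<Rightarrow> bool" where
  "max_pair b P Q \<longleftrightarrow> path_pair b P Q \<and>
     (\<forall>P' Q'. path_pair b P' Q' \<longrightarrow> length P' + length Q' \<le> length P + length Q)"

lemma path_pair_swap: "path_pair b P Q \<longleftrightarrow> path_pair (\<not> b) Q P"
  by (auto simp: path_pair_def)

lemma max_pair_swap: "max_pair b P Q \<longleftrightarrow> max_pair (\<not> b) Q P"
  unfolding max_pair_def using path_pair_swap by (metis add.commute)

lemma max_pair_rev:
  "max_pair b (rev P) Q \<longleftrightarrow> max_pair b P Q" "max_pair b P (rev Q) \<longleftrightarrow> max_pair b P Q"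
  by (simp_all add: max_pair_def path_pair_def)

lemma path_pair_length:
  assumes "path_pair b P Q"
  shows "length P + length Q = card (set P \<union> set Q)" "set P \<union> set Q \<subseteq> X \<union> Y"
  using assms mono_path_length mono_path_subset[of b P] mono_path_subset[of "\<not> b" Q]
  by (auto simp: path_pair_def card_Un_disjoint)

lemma card_XY: "card (X \<union> Y) = 2 * card X"
  using fin disj balanced by (simp add: card_Un_disjoint)

lemma path_pair_length_le:
  assumes "path_pair b P Q"
  shows "length P + length Q \<le> 2 * card X"
  using path_pair_length[OF assms] fin card_XY by (metis card_mono finite_Un)

lemma max_pair_exists: "\<exists>P Q. max_pair b P Q"
proof -
  have "path_pair b (fst ([], [])) (snd ([], []))" by (simp add: path_pair_def)
  moreover have "\<forall>z. path_pair b (fst z) (snd z) \<longrightarrow> length (fst z) + length (snd z) < Suc (2 * card X)"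
    using path_pair_length_le by (simp add: less_Suc_eq_le)
  ultimately have "\<exists>z. path_pair b (fst z) (snd z) \<and> (\<forall>z'. path_pair b (fst z') (snd z') \<longrightarrow>
      length (fst z') + length (snd z') \<le> length (fst z) + length (snd z))"
    by (rule ex_has_greatest_nat)
  thus ?thesis by (auto simp: max_pair_def)
qed

lemma max_pair_trans:
  assumes "max_pair b P Q" "path_pair b P' Q'" "length P' + length Q' \<ge> length P + length Q"
  shows "max_pair b P' Q'" "length P' + length Q' = length P + length Q"
  using assms by (auto simp: max_pair_def intro: le_trans antisym)

lemma uncovered_balance:
  assumes "path_pair b P Q" "P \<noteq> []" "Q \<noteq> []"
  shows "2 * (int (card (X - set P - set Q)) - int (card (Y - set P - set Q))) =
           side (hd P) + side (last P) + side (hd Q) + side (last Q)"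
proof -
  have *: "int (card (Z - set P - set Q)) = int (card Z) - int (card (set P \<inter> Z)) - int (card (set Q \<inter> Z))"
    if "finite Z" for Z :: "'a set"
  proof -
    have "Z - set P - set Q = Z - ((set P \<inter> Z) \<union> (set Q \<inter> Z))" by blast
    moreover have "card ((set P \<inter> Z) \<union> (set Q \<inter> Z)) \<le> card Z"
      using that by (intro card_mono) auto
    ultimately have "card Z = card (Z - set P - set Q) + card ((set P \<inter> Z) \<union> (set Q \<inter> Z))"
      by (simp add: card_Diff_subset)
    moreover have "card ((set P \<inter> Z) \<union> (set Q \<inter> Z)) = card (set P \<inter> Z) + card (set Q \<inter> Z)"
      using assms(1) by (intro card_Un_disjoint) (auto simp: path_pair_def)
    ultimately show ?thesis by simp
  qed
  show ?thesis
    using mono_path_balance[of b P] mono_path_balance[of "\<not> b" Q] assms *[OF fin(1)] *[OF fin(2)] balanced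
    by (simp add: path_pair_def)
qed

lemma uncovered_count:
  assumes "path_pair b P Q"
  shows "card (X - set P - set Q) + card (Y - set P - set Q) + (length P + length Q) = 2 * card X"
proof -
  have eq: "X \<union> Y - (set P \<union> set Q) = (X - set P - set Q) \<union> (Y - set P - set Q)" by blast
  have "card ((X - set P - set Q) \<union> (Y - set P - set Q)) =
      card (X - set P - set Q) + card (Y - set P - set Q)"
    using fin disj by (intro card_Un_disjoint) auto
  moreover have "card (X \<union> Y - (set P \<union> set Q)) = card (X \<union> Y) - card (set P \<union> set Q)"
    using path_pair_length(2)[OF assms] by (intro card_Diff_subset) auto
  moreover have "card (set P \<union> set Q) \<le> card (X \<union> Y)"
    using path_pair_length(2)[OF assms] fin by (intro card_mono) auto
  ultimately show ?thesis
    using path_pair_length(1)[OF assms] card_XY unfolding eq by linarith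
qed

text \<open>A maximal pair that misses at least two vertices. The exchanges below replace a stuck pair
by another pair with the same total length, which is stuck again.\<close>

definition stuck :: "bool \<Rightarrow> 'a list \<Rightarrow> 'a list \<Rightarrow> bool" where
  "stuck b P Q \<longleftrightarrow> max_pair b P Q \<and> length P + length Q + 2 \<le> 2 * card X"

lemma stuck_swap: "stuck b P Q \<longleftrightarrow> stuck (\<not> b) Q P"
  using max_pair_swap by (auto simp: stuck_def add.commute)

lemma stuck_rev: "stuck b (rev P) Q \<longleftrightarrow> stuck b P Q" "stuck b P (rev Q) \<longleftrightarrow> stuck b P Q"
  by (simp_all add: stuck_def max_pair_rev)

lemma max_pair_no_gain:
  assumes "max_pair b P Q" "path_pair b P' Q'"
  shows "\<not> length P + length Q < length P' + length Q'"
  using assms by (auto simp: max_pair_def not_less)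

lemma max_pair_nonempty:
  assumes "max_pair b P Q" "u \<in> X \<union> Y - set P - set Q"
  shows "P \<noteq> []" "Q \<noteq> []"
proof -
  have pp: "path_pair b P Q" using assms by (simp add: max_pair_def)
  show "P \<noteq> []"
    using max_pair_no_gain[OF assms(1), of "[u]" Q] pp assms(2) by (auto simp: path_pair_def)
  show "Q \<noteq> []"
    using max_pair_no_gain[OF assms(1), of P "[u]"] pp assms(2) by (auto simp: path_pair_def)
qed

lemma max_pair_not_adj:
  assumes "max_pair b P Q" "u \<in> X \<union> Y - set P - set Q"
  shows "\<not> adj b u (hd P)" "\<not> adj (\<not> b) u (hd Q)" "\<not> adj b u (last P)" "\<not> adj (\<not> b) u (last Q)"
proof -
  have *: "\<not> adj b u (hd P)" if "max_pair b P Q" "u \<in> X \<union> Y - set P - set Q" for b P Q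
    using max_pair_no_gain[OF that(1), of "u # P" Q] that by (auto simp: path_pair_def max_pair_def)
  show "\<not> adj b u (hd P)" using * assms by blast
  show "\<not> adj (\<not> b) u (hd Q)" using *[of "\<not> b" Q P] assms max_pair_swap by blast
  show "\<not> adj b u (last P)"
    using *[of b "rev P" Q] assms by (auto simp: max_pair_rev hd_rev)
  show "\<not> adj (\<not> b) u (last Q)"
    using *[of "\<not> b" "rev Q" P] assms max_pair_swap[of b P "rev Q"] by (auto simp: max_pair_rev hd_rev)
qed

lemma stuck_nonempty:
  assumes "stuck b P Q"
  shows "P \<noteq> []" "Q \<noteq> []"
proof -
  have mp: "max_pair b P Q" and pp: "path_pair b P Q"
    using assms by (auto simp: stuck_def max_pair_def)
  have "card (X - set P - set Q) \<noteq> 0 \<or> card (Y - set P - set Q) \<noteq> 0"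
    using uncovered_count[OF pp] assms unfolding stuck_def by linarith
  then obtain u where "u \<in> X - set P - set Q \<or> u \<in> Y - set P - set Q"
    by (metis card.empty ex_in_conv)
  hence "u \<in> X \<union> Y - set P - set Q" by blast
  thus "P \<noteq> []" "Q \<noteq> []" using max_pair_nonempty[OF mp] by blast+
qed

text \<open>Suppose that \<open>P\<close> ends in \<open>p \<in> Y\<close> and \<open>Q\<close> ends in \<open>q \<in> X\<close>. Since the signs of the four ends
do not all agree, the uncovered vertices do not lie on one side, so there are uncovered \<open>v \<in> X\<close>
and \<open>w \<in> Y\<close>. Maximality fixes the colours of \<open>vp\<close> and \<open>wq\<close>, and then the edge \<open>pq\<close>, whatever its
colour, lets one path take over the end of the other and gain an uncovered vertex.\<close>

lemma stuck_ends_not_opposite: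
  assumes st: "stuck b P Q"
  shows "\<not> (hd P \<in> Y \<and> hd Q \<in> X)"
proof
  assume ends: "hd P \<in> Y \<and> hd Q \<in> X"
  have mp: "max_pair b P Q" and pp: "path_pair b P Q"
    using st by (auto simp: stuck_def max_pair_def)
  note ne = stuck_nonempty[OF st]
  let ?UX = "X - set P - set Q" and ?UY = "Y - set P - set Q"
  have cnt: "card ?UX + card ?UY \<ge> 2" using uncovered_count[OF pp] st by (simp add: stuck_def)
  have bal: "2 * (int (card ?UX) - int (card ?UY)) = side (hd P) + side (last P) + side (hd Q) + side (last Q)"
    by (rule uncovered_balance[OF pp ne])
  have sd: "side (hd P) = 1" "side (hd Q) = -1" "side (last P) \<le> 1" "side (last Q) \<le> 1"
      "- 1 \<le> side (last P)" "- 1 \<le> side (last Q)"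
    using ends disj by (auto simp: side_def)
  have "2 \<le> int (card ?UX) + int (card ?UY)" using cnt by linarith
  hence "0 < int (card ?UX) \<and> 0 < int (card ?UY)" using bal sd by presburger
  hence "0 < card ?UX" "0 < card ?UY" by simp_all
  then obtain v w where v: "v \<in> ?UX" and w: "w \<in> ?UY"
    by (metis card.empty ex_in_conv less_irrefl)
  obtain p P' where P: "P = p # P'" using ne by (cases P) auto
  obtain q Q' where Q: "Q = q # Q'" using ne by (cases Q) auto
  have pY: "p \<in> Y" and qX: "q \<in> X" using ends P Q by auto
  have vp: "adj (\<not> b) v p" using max_pair_not_adj(1)[OF mp, of v] v P pY adj_cross(1)[of v p b] by auto
  have wq: "adj b w q" using max_pair_not_adj(2)[OF mp, of w] w Q qX adj_cross(2)[of q w b] by auto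
  show False
  proof (cases "adj b q p")
    case True
    hence "path_pair b (w # q # P) Q'"
      using pp wq w v P Q pY qX disj by (auto simp: path_pair_def)
    thus False using max_pair_no_gain[OF mp] P Q by fastforce
  next
    case False
    hence "adj (\<not> b) p q" using adj_cross(1)[of q p b] pY qX adj_sym by blast
    hence "path_pair b P' (v # p # Q)"
      using pp vp w v P Q pY qX disj by (auto simp: path_pair_def)
    thus False using max_pair_no_gain[OF mp] P Q by fastforce
  qed
qed

lemma stuck_ends:
  assumes st: "stuck b P Q"
  shows "hd P \<in> Y \<longleftrightarrow> hd Q \<in> Y" "hd P \<in> Y \<longleftrightarrow> last P \<in> Y" "hd P \<in> Y \<longleftrightarrow> last Q \<in> Y"
proof -
  have *: "hd P \<in> Y \<longleftrightarrow> hd Q \<in> Y" if st: "stuck b P Q" for b P Q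
  proof -
    have "hd P \<in> set P" "hd Q \<in> set Q" using stuck_nonempty[OF st] by auto
    moreover have "set P \<union> set Q \<subseteq> X \<union> Y"
      using st by (intro path_pair_length(2)[of b]) (auto simp: stuck_def max_pair_def)
    ultimately have "hd P \<in> X \<union> Y" "hd Q \<in> X \<union> Y" by blast+
    thus ?thesis
      using stuck_ends_not_opposite[OF st] stuck_ends_not_opposite[of "\<not> b" Q P] st stuck_swap[of b P Q] disj by blast
  qed
  show 1: "hd P \<in> Y \<longleftrightarrow> hd Q \<in> Y" by (rule *[OF st])
  show 2: "hd P \<in> Y \<longleftrightarrow> last Q \<in> Y" using *[of b P "rev Q"] st by (simp add: stuck_rev hd_rev)
  show "hd P \<in> Y \<longleftrightarrow> last P \<in> Y" using *[of b "rev P" Q] st 1 by (simp add: stuck_rev hd_rev)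
qed

lemma stuck_trans:
  assumes "stuck b P Q" "path_pair b P' Q'" "length P' + length Q' \<ge> length P + length Q"
  shows "stuck b P' Q'"
  using assms max_pair_trans[of b P Q P' Q'] by (auto simp: stuck_def)

lemma stuck_uncovered:
  assumes st: "stuck b P Q" and Y: "hd P \<in> Y"
  shows "X - set P - set Q \<noteq> {}"
proof -
  have pp: "path_pair b P Q" using st by (auto simp: stuck_def max_pair_def)
  have "side (hd P) = 1" "side (last P) = 1" "side (hd Q) = 1" "side (last Q) = 1"
    using stuck_ends[OF st] Y by (auto simp: side_def)
  hence "0 < int (card (X - set P - set Q))"
    using uncovered_balance[OF pp stuck_nonempty[OF st]] by presburger
  hence "0 < card (X - set P - set Q)" by simp
  thus ?thesis by (metis card.empty less_irrefl)
qed

text \<open>If the end of \<open>P\<close> were joined to the second vertex of \<open>Q\<close> in the colour of \<open>Q\<close>, then \<open>Q\<close>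
could replace its first vertex \<open>q\<close> by that end of \<open>P\<close> and an uncovered vertex \<open>v\<close> before it. The
new pair has the same total length, but ends on both sides, which is impossible for a stuck pair.
The same exchange excludes that \<open>Q\<close> consists of \<open>q\<close> alone.\<close>

lemma stuck_second:
  assumes st: "stuck b P (q # Q)" and Y: "hd P \<in> Y"
  shows "Q \<noteq> []" "adj b (hd P) (hd Q)"
proof -
  have mp: "max_pair b P (q # Q)" and pp: "path_pair b P (q # Q)"
    using st by (auto simp: stuck_def max_pair_def)
  obtain v where v: "v \<in> X - set P - set (q # Q)" using stuck_uncovered[OF st Y] by blast
  obtain p P' where P: "P = p # P'" using stuck_nonempty[OF st] by (cases P) auto
  have pY: "p \<in> Y" using Y P by simp
  have vp: "adj (\<not> b) v p" using max_pair_not_adj(1)[OF mp, of v] v P pY adj_cross(1)[of v p b] by auto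
  have no: "\<not> (Q = [] \<or> adj (\<not> b) p (hd Q))"
  proof
    assume "Q = [] \<or> adj (\<not> b) p (hd Q)"
    hence Q': "mono_path (\<not> b) (v # p # Q)"
      using pp v P pY vp by (auto simp: path_pair_def)
    \<comment> \<open>If \<open>P\<close> has lost its only vertex, the released \<open>q\<close> takes its place and the total length grows.\<close>
    show False
    proof (cases "P' = []")
      case True
      have "path_pair b [q] (v # p # Q)" using Q' pp v P by (auto simp: path_pair_def)
      thus False using max_pair_no_gain[OF mp] P True by fastforce
    next
      case False
      have "path_pair b P' (v # p # Q)" using Q' pp v P by (auto simp: path_pair_def)
      hence st': "stuck b P' (v # p # Q)" using stuck_trans[OF st] P by auto
      have "last P' \<in> Y" using stuck_ends(2)[OF st] Y P False by simp
      thus False using stuck_ends[OF st'] v disj by auto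
    qed
  qed
  thus "Q \<noteq> []" by blast
  hence "adj (\<not> b) q (hd Q)" "q \<in> Y" using pp stuck_ends(1)[OF st] Y by (auto simp: path_pair_def)
  hence "hd Q \<in> X" using adj_side by blast
  thus "adj b (hd P) (hd Q)" using adj_cross(2)[of "hd Q" p b] pY no P by auto
qed

text \<open>Both ends of \<open>P\<close> are joined to the second vertex of \<open>Q\<close> in the colour of \<open>P\<close>, which closes
\<open>P\<close> to a cycle.\<close>

lemma stuck_cycle:
  assumes st: "stuck b P (q # Q)" and Y: "hd P \<in> Y"
  shows "mono_path b (hd Q # P)" "adj b (last (hd Q # P)) (hd (hd Q # P))"
    "Q \<noteq> []" "tl Q \<noteq> []" "hd Q \<in> X"
proof -
  have pp: "path_pair b P (q # Q)" using st by (auto simp: stuck_def max_pair_def)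
  note sec = stuck_second[OF st Y]
  show ne: "Q \<noteq> []" by (fact sec)
  have last: "last P \<in> Y" "last Q \<in> Y" using stuck_ends[OF st] Y ne by auto
  show X: "hd Q \<in> X" using sec(2) Y adj_side by blast
  show "tl Q \<noteq> []" using last(2) X disj ne by (cases Q) auto
  have "adj b (last P) (hd Q)"
    using stuck_second(2)[of b "rev P" q Q] st last by (simp add: stuck_rev hd_rev)
  thus "adj b (last (hd Q # P)) (hd (hd Q # P))" using stuck_nonempty[OF st] by simp
  have "hd Q \<in> set Q" "set P \<inter> set Q = {}" using ne pp by (auto simp: path_pair_def)
  thus "mono_path b (hd Q # P)" using sec(2) X pp adj_sym by (auto simp: path_pair_def)
qed

text \<open>Otherwise \<open>v\<close> could be attached to the cycle of \<open>stuck_cycle\<close>, cut open at \<open>y\<close>. This path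
uses the second vertex of \<open>Q\<close> and \<open>v\<close>, and the first vertex of \<open>Q\<close> is given up, so the total
length is unchanged, but there are ends on both sides.\<close>

lemma stuck_colour:
  assumes st: "stuck b P Q" and Y: "hd P \<in> Y" and v: "v \<in> X - set P - set Q"
    and y: "y \<in> set P \<inter> Y"
  shows "C v y = (\<not> b)"
proof (rule ccontr)
  assume "C v y \<noteq> (\<not> b)"
  hence vy: "adj b v y" using v y by (auto simp: adj_def)
  obtain q Q' where Q: "Q = q # Q'" using stuck_nonempty[OF st] by (cases Q) auto
  note st = st[unfolded Q]
  have pp: "path_pair b P (q # Q')" using st by (auto simp: stuck_def max_pair_def)
  note cyc = stuck_cycle[OF st Y]
  obtain zs where zs: "mono_path b zs" "set zs = set (hd Q' # P)" "hd zs = y" "zs \<noteq> []"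
      "length zs = length (hd Q' # P)"
    by (rule mono_path_closed_rotate[OF cyc(1,2), of y]) (use y in auto)
  obtain z R where R: "Q' = z # R" using cyc(3) by (cases Q') auto
  have "path_pair b (v # zs) R"
    using zs vy v Q R pp by (auto simp: path_pair_def)
  hence st': "stuck b (v # zs) R" using stuck_trans[OF st] zs R by auto
  have "last R \<in> Y" using stuck_ends(3)[OF st] Y cyc(4) R by simp
  thus False using stuck_ends(3)[OF st'] v disj by auto
qed

text \<open>The pair is chosen with \<open>P\<close> as long as possible among the stuck pairs that miss \<open>v\<close>.
Consider an uncovered \<open>w \<in> Y\<close> joined to \<open>v\<close> in the colour of \<open>Q\<close>, and its edge to the second
vertex \<open>z\<close> of \<open>Q\<close>. In the colour of \<open>P\<close> this edge would extend \<open>P\<close> by \<open>z\<close> and \<open>w\<close> at the cost of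
the first vertex of \<open>Q\<close>. In the colour of \<open>Q\<close> it would allow \<open>w\<close> to replace the first vertex of
\<open>Q\<close>, and then \<open>stuck_colour\<close> with the colours swapped contradicts the colour of \<open>vw\<close>. Hence \<open>P\<close>
contains all neighbours of \<open>v\<close> in the colour of \<open>Q\<close>, and so does the cycle through \<open>P\<close> and \<open>z\<close>.\<close>

lemma stuck_degree_cycle:
  assumes st: "stuck b P Q" and Y: "hd P \<in> Y" and v: "v \<in> X - set P - set Q"
  shows "\<exists>zs. mono_path b zs \<and> adj b (last zs) (hd zs) \<and> v \<notin> set zs \<and>
           set zs \<inter> Y = {y \<in> Y. C v y = (\<not> b)} \<and> length zs = 2 * card {y \<in> Y. C v y = (\<not> b)}"
proof -
  let ?ok = "\<lambda>z. stuck b (fst z) (snd z) \<and> hd (fst z) \<in> Y \<and> v \<in> X - set (fst z) - set (snd z)"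
  have "?ok (P, Q)" using assms by simp
  moreover have "\<forall>z. ?ok z \<longrightarrow> length (fst z) < Suc (2 * card X)"
    by (auto simp: stuck_def)
  ultimately have "\<exists>z. ?ok z \<and> (\<forall>z'. ?ok z' \<longrightarrow> length (fst z') \<le> length (fst z))"
    by (rule ex_has_greatest_nat)
  then obtain P Q where st: "stuck b P Q" and Y: "hd P \<in> Y" and v: "v \<in> X - set P - set Q"
    and mx: "\<And>P' Q'. stuck b P' Q' \<Longrightarrow> hd P' \<in> Y \<Longrightarrow> v \<in> X - set P' - set Q' \<Longrightarrow> length P' \<le> length P"
    by fastforce
  obtain q Q' where Q: "Q = q # Q'" using stuck_nonempty[OF st] by (cases Q) auto
  have pp: "path_pair b P (q # Q')" using st Q by (auto simp: stuck_def max_pair_def)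
  note cyc = stuck_cycle[OF st[unfolded Q] Y]
  obtain z R where R: "Q' = z # R" using cyc(3) by (cases Q') auto
  have qY: "hd Q \<in> Y" using stuck_ends(1)[OF st] Y by simp
  have N: "set P \<inter> Y = {y \<in> Y. C v y = (\<not> b)}"
  proof
    show "set P \<inter> Y \<subseteq> {y \<in> Y. C v y = (\<not> b)}" using stuck_colour[OF st Y v] by auto
    show "{y \<in> Y. C v y = (\<not> b)} \<subseteq> set P \<inter> Y"
    proof (rule subsetI, rule ccontr)
      fix w assume w: "w \<in> {y \<in> Y. C v y = (\<not> b)}" "w \<notin> set P \<inter> Y"
      have "w \<notin> set Q"
        using stuck_colour[of "\<not> b" Q P v w] st stuck_swap[of b P Q] qY v w by auto
      hence wu: "w \<in> Y - set P - set Q" using w by auto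
      have "w \<noteq> v" using w v disj by auto
      show False
      proof (cases "adj b w z")
        case True
        have "path_pair b (w # z # P) R"
          using True cyc(1) wu Q R pp by (auto simp: path_pair_def)
        hence "stuck b (w # z # P) R" using stuck_trans[OF st] Q R by auto
        moreover have "v \<in> X - set (w # z # P) - set R" using v Q R \<open>w \<noteq> v\<close> by auto
        ultimately show False using mx[of "w # z # P" R] wu by auto
      next
        case False
        hence "adj (\<not> b) w z" using adj_cross(2)[of z w b] cyc(5) R wu by auto
        hence "path_pair b P (w # Q')"
          using wu Q R pp by (auto simp: path_pair_def)
        hence st': "stuck b P (w # Q')" using stuck_trans[OF st] Q by auto
        have "v \<in> X - set (w # Q') - set P" using v Q \<open>w \<noteq> v\<close> by auto
        hence "C v w = b"
          using stuck_colour[of "\<not> b" "w # Q'" P v w] st' stuck_swap[of b P "w # Q'"] wu by auto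
        thus False using w by auto
      qed
    qed
  qed
  have "side (hd P) = 1" "side (last P) = 1"
    using stuck_ends[OF st] Y by (auto simp: side_def)
  hence "int (card (set P \<inter> Y)) = int (card (set P \<inter> X)) + 1"
    using mono_path_balance[of b P] pp stuck_nonempty[OF st] by (simp add: path_pair_def)
  hence "length (z # P) = 2 * card (set P \<inter> Y)"
    using mono_path_length_sides[of b P] pp by (simp add: path_pair_def)
  moreover have "set (z # P) \<inter> Y = set P \<inter> Y" "v \<notin> set (z # P)"
    using cyc(5) R disj v Q by auto
  ultimately show ?thesis
    using cyc(1,2) R N by (intro exI[of _ "z # P"]) auto
qed

section \<open>Pairs that miss at most one vertex\<close>

lemma side_cases: "side x = 1 \<or> side x = - 1"
  by (simp add: side_def)

lemma adj_iff_side: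
  "adj b x y \<longleftrightarrow> x \<in> X \<union> Y \<and> y \<in> X \<union> Y \<and> side x = - side y \<and> C x y = b"
  using disj by (auto simp: adj_def side_def)

lemma adj_opposite:
  "x \<in> X \<union> Y \<Longrightarrow> y \<in> X \<union> Y \<Longrightarrow> side x = - side y \<Longrightarrow> \<not> adj b x y \<Longrightarrow> adj (\<not> b) x y"
  by (auto simp: adj_iff_side)

lemma mono_path_last_side:
  assumes "mono_path b xs" "xs \<noteq> []"
  shows "side (last xs) = (if even (length xs) then - side (hd xs) else side (hd xs))"
  using assms
proof (induction xs)
  case (Cons x xs)
  show ?case
  proof (cases "xs = []")
    case False
    hence "side x = - side (hd xs)" using Cons.prems by (simp add: adj_iff_side)
    thus ?thesis using Cons False by simp
  qed simp
qed simp

lemma mono_path_shorten: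
  assumes "mono_path b xs" "n \<le> length xs"
  shows "\<exists>ys. mono_path b ys \<and> length ys = n"
  using assms mono_path_take[of b xs n] by (intro exI[of _ "take n xs"]) auto

lemma mono_path_hd_last: "mono_path b xs \<Longrightarrow> xs \<noteq> [] \<Longrightarrow> hd xs \<in> X \<union> Y \<and> last xs \<in> X \<union> Y"
  using mono_path_subset[of b xs] by (meson hd_in_set last_in_set subsetD)

text \<open>In a spanning pair the signs of the ends cancel. If both paths have odd length, each has
its two ends on one side, hence the paths end on opposite sides and the edge between their first
vertices extends one of them by an end of the other.\<close>

lemma odd_cover_exchange:
  assumes pp: "path_pair b P Q" and len: "length P + length Q = 2 * card X" and odd: "odd (length P)"
  shows "(\<exists>xs. mono_path (\<not> b) xs \<and> length xs = length Q + 1) \<or>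
         path_pair b (hd Q # P) (tl Q)"
proof -
  have oddQ: "odd (length Q)" using len odd by (metis even_add even_mult_iff even_numeral)
  have ne: "P \<noteq> []" "Q \<noteq> []" using odd oddQ by auto
  have P: "mono_path b P" and Q: "mono_path (\<not> b) Q" and d: "set P \<inter> set Q = {}"
    using pp by (auto simp: path_pair_def)
  have "card (X - set P - set Q) = 0" "card (Y - set P - set Q) = 0"
    using uncovered_count[OF pp] len by linarith+
  hence "side (hd P) + side (last P) + side (hd Q) + side (last Q) = 0"
    using uncovered_balance[OF pp ne] by simp
  hence sd: "side (hd P) = - side (hd Q)"
    using mono_path_last_side[OF P ne(1)] mono_path_last_side[OF Q ne(2)] odd oddQ by simp
  show ?thesis
  proof (cases "adj b (hd P) (hd Q)")
    case True
    have "path_pair b (hd Q # P) (tl Q)"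
      using True pp ne mono_path_hd_last[OF Q ne(2)] adj_sym[of b]
      by (cases Q) (auto simp: path_pair_def)
    thus ?thesis by blast
  next
    case False
    hence "adj (\<not> b) (hd P) (hd Q)"
      using adj_opposite sd mono_path_hd_last P Q ne by blast
    hence "mono_path (\<not> b) (hd P # Q)"
      using Q d ne mono_path_hd_last[OF P ne(1)] by (cases P) auto
    thus ?thesis by (intro disjI1 exI[of _ "hd P # Q"]) simp
  qed
qed

lemma path_pair_rev:
  "path_pair b (rev P) Q \<longleftrightarrow> path_pair b P Q" "path_pair b P (rev Q) \<longleftrightarrow> path_pair b P Q"
  by (simp_all add: path_pair_def)

text \<open>Each path has one end on either side, so there are two disjoint edges joining the ends of
\<open>P\<close> to those of \<open>Q\<close>. Either one of them has the colour of \<open>P\<close> and extends \<open>P\<close>, or both extend \<open>Q\<close>,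
at different ends.\<close>

lemma even_cover_extend:
  assumes pp: "path_pair b P Q" and ev: "even (length P)" "even (length Q)" and ne: "P \<noteq> []" "Q \<noteq> []"
  shows "(\<exists>xs. mono_path b xs \<and> length xs = length P + 1) \<or>
         (\<exists>xs. mono_path (\<not> b) xs \<and> length xs = length Q + 2)"
proof -
  define P' where "P' = (if side (hd P) = - side (hd Q) then P else rev P)"
  have pp': "path_pair b P' Q" and len: "length P' = length P" and ne': "P' \<noteq> []"
    using pp ne by (auto simp: P'_def path_pair_rev)
  have P: "mono_path b P'" and Q: "mono_path (\<not> b) Q" and d: "set P' \<inter> set Q = {}"
    using pp' by (auto simp: path_pair_def)
  have sP: "side (last P) = - side (hd P)"
    using mono_path_last_side[of b P] pp ev ne by (simp add: path_pair_def)
  have sd: "side (hd P') = - side (hd Q)"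
    using side_cases[of "hd P"] side_cases[of "hd Q"] sP by (auto simp: P'_def hd_rev)
  have sl: "side (last P') = - side (last Q)"
    using mono_path_last_side[OF P ne'] mono_path_last_side[OF Q ne(2)] ev len sd by simp
  note ends = mono_path_hd_last[OF P ne'] mono_path_hd_last[OF Q ne(2)]
  consider "adj b (hd P') (hd Q)" | "adj b (last P') (last Q)"
    | "adj (\<not> b) (hd P') (hd Q)" "adj (\<not> b) (last P') (last Q)"
    using adj_opposite sd sl ends by blast
  thus ?thesis
  proof cases
    case 1
    have "hd Q \<notin> set P'" using d ne by (meson disjoint_iff hd_in_set)
    hence "mono_path b (hd Q # P')" using 1 P ends adj_sym[of b] by simp
    thus ?thesis using len by (intro disjI1 exI[of _ "hd Q # P'"]) simp
  next
    case 2
    have "last Q \<notin> set P'" using d ne by (meson disjoint_iff last_in_set)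
    hence "mono_path b (P' @ [last Q])" using 2 P ends by (auto simp: mono_path_append)
    thus ?thesis using len by (intro disjI1 exI[of _ "P' @ [last Q]"]) simp
  next
    case 3
    have "hd P' \<notin> set Q" "last P' \<notin> set Q" using d ne' by (meson disjoint_iff hd_in_set last_in_set)+
    moreover have "hd P' \<noteq> last P'"
      using mono_path_last_side[OF P ne'] ev len side_cases[of "hd P'"] by auto
    ultimately have "mono_path (\<not> b) (hd P' # Q @ [last P'])"
      using 3 Q ends ne adj_sym by (auto simp: mono_path_append)
    thus ?thesis by (intro disjI2 exI[of _ "hd P' # Q @ [last P']"]) simp
  qed
qed

lemma max_pair_one_uncovered:
  assumes mp: "max_pair b P Q" and len: "Suc (length P + length Q) = 2 * card X"
  obtains u where "u \<in> X \<union> Y - set P - set Q" "P \<noteq> []" "Q \<noteq> []"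
    "- 2 * side u = side (hd P) + side (last P) + side (hd Q) + side (last Q)"
proof -
  let ?UX = "X - set P - set Q" and ?UY = "Y - set P - set Q"
  have pp: "path_pair b P Q" using mp by (simp add: max_pair_def)
  have cnt: "card ?UX + card ?UY = 1" using uncovered_count[OF pp] len by linarith
  hence "card ?UX \<noteq> 0 \<or> card ?UY \<noteq> 0" by linarith
  then obtain u where u: "u \<in> ?UX \<or> u \<in> ?UY" by (metis card.empty ex_in_conv)
  hence u': "u \<in> X \<union> Y - set P - set Q" by blast
  note ne = max_pair_nonempty[OF mp u']
  have "0 < card ?UX" if "u \<in> ?UX" using that fin by (auto simp: card_gt_0_iff)
  moreover have "0 < card ?UY" if "u \<in> ?UY" using that fin by (auto simp: card_gt_0_iff)
  ultimately have "int (card ?UX) - int (card ?UY) = - side u"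
    using u cnt disj by (auto simp: side_def)
  hence "- 2 * side u = side (hd P) + side (last P) + side (hd Q) + side (last Q)"
    using uncovered_balance[OF pp ne] by presburger
  thus thesis using that u' ne by blast
qed

text \<open>The common situation of the next three lemmas, in the last one with the colours swapped.
The path \<open>P\<close>, reversed if necessary, starts opposite to the ends of \<open>Q\<close>, and the balance of the
sides puts the missed vertex \<open>u\<close> opposite to them as well.\<close>

lemma even_odd_cover_ends:
  assumes mp: "max_pair b P Q" and len: "Suc (length P + length Q) = 2 * card X"
    and ev: "even (length P)"
  obtains u P' where "u \<in> X \<union> Y - set P' - set Q" "max_pair b P' Q" "length P' = length P"
    "P' \<noteq> []" "Q \<noteq> []" "side u = - side (hd Q)" "side (last Q) = side (hd Q)"
    "side (hd P') = - side (hd Q)" "side (last P') = side (hd Q)"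
    "adj b u (hd Q)" "adj b u (last Q)" "odd (length Q)"
proof -
  obtain u where u: "u \<in> X \<union> Y - set P - set Q" "P \<noteq> []" "Q \<noteq> []"
    "- 2 * side u = side (hd P) + side (last P) + side (hd Q) + side (last Q)"
    using max_pair_one_uncovered[OF mp len] .
  define P' where "P' = (if side (hd P) = - side (hd Q) then P else rev P)"
  have P: "mono_path b P" and Q: "mono_path (\<not> b) Q"
    using mp by (auto simp: max_pair_def path_pair_def)
  have oddQ: "odd (length Q)" using len ev by presburger
  have sP: "side (last P) = - side (hd P)"
    using mono_path_last_side[OF P u(2)] ev by simp
  have sQ: "side (last Q) = side (hd Q)"
    using mono_path_last_side[OF Q u(3)] oddQ by simp
  have su: "side u = - side (hd Q)" using u(4) sP sQ by linarith
  have mp': "max_pair b P' Q" "length P' = length P" "P' \<noteq> []" "set P' = set P"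
    using mp u by (auto simp: P'_def max_pair_rev)
  have sP': "side (hd P') = - side (hd Q)" "side (last P') = side (hd Q)"
    using side_cases[of "hd P"] side_cases[of "hd Q"] sP by (auto simp: P'_def hd_rev last_rev)
  have "adj b u (hd Q)" "adj b u (last Q)"
    using max_pair_not_adj(2,4)[OF mp u(1)] mono_path_hd_last[OF Q u(3)] u(1) su sQ
      adj_opposite[of u _ "\<not> b"] by auto
  thus thesis using that[of u P'] u mp' su sQ sP' oddQ by auto
qed

text \<open>If the edge from the start of \<open>P\<close> to the start of \<open>Q\<close> does not extend \<open>Q\<close>, then \<open>P\<close>
continues through the start of \<open>Q\<close> to the missed vertex \<open>u\<close>, and further to the other end of \<open>Q\<close>
if that is a different vertex.\<close>

lemma even_odd_cover_extend_even:
  assumes mp: "max_pair b P Q" and len: "Suc (length P + length Q) = 2 * card X"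
    and ev: "even (length P)"
  shows "(\<exists>xs. mono_path b xs \<and> length xs = length P + (if length Q = 1 then 2 else 3)) \<or>
         (\<exists>xs. mono_path (\<not> b) xs \<and> length xs = length Q + 1)"
proof -
  from even_odd_cover_ends[OF assms] obtain u P' where *:
    "u \<in> X \<union> Y - set P' - set Q" "max_pair b P' Q" "length P' = length P"
    "P' \<noteq> []" "Q \<noteq> []" "side u = - side (hd Q)" "side (last Q) = side (hd Q)"
    "side (hd P') = - side (hd Q)" "side (last P') = side (hd Q)"
    "adj b u (hd Q)" "adj b u (last Q)" "odd (length Q)" .
  have P: "mono_path b P'" and Q: "mono_path (\<not> b) Q" and d: "set P' \<inter> set Q = {}"
    using *(2) by (auto simp: max_pair_def path_pair_def)
  note ends = mono_path_hd_last[OF P *(4)] mono_path_hd_last[OF Q *(5)]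
  have out: "hd P' \<notin> set Q" "hd Q \<notin> set P'" "last Q \<notin> set P'"
    using d *(4,5) by (meson disjoint_iff hd_in_set last_in_set)+
  show ?thesis
  proof (cases "adj b (hd P') (hd Q)")
    case False
    hence "adj (\<not> b) (hd P') (hd Q)" using adj_opposite *(8) ends by blast
    hence "mono_path (\<not> b) (hd P' # Q)" using Q out ends by simp
    thus ?thesis by (intro disjI2 exI[of _ "hd P' # Q"]) simp
  next
    case True
    hence 1: "mono_path b (u # hd Q # P')" using P *(1,10) out ends adj_sym *(5) by auto
    show ?thesis
    proof (cases "length Q = 1")
      case True
      thus ?thesis using 1 *(3) by (intro disjI1 exI[of _ "u # hd Q # P'"]) simp
    next
      case False
      obtain q R where QR: "Q = q # R" "R \<noteq> []" using False *(5) by (cases Q) auto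
      have "hd Q \<noteq> last Q" using QR Q by (auto simp: mono_path_def)
      hence "mono_path b (last Q # u # hd Q # P')"
        using 1 *(1,5,11) out ends adj_sym by auto
      thus ?thesis using *(3) False by (intro disjI1 exI[of _ "last Q # u # hd Q # P'"]) simp
    qed
  qed
qed

text \<open>If \<open>P\<close> cannot be extended by even one vertex, its start \<open>x\<close> closes \<open>Q\<close> to a cycle. Its
other end \<open>y\<close> is joined in the colour of \<open>Q\<close> to the missed vertex \<open>u\<close> and to the second vertex \<open>z\<close>
of \<open>Q\<close>. The path \<open>u, y\<close> followed by the cycle, cut open at \<open>z\<close>, has three vertices more than \<open>Q\<close>.\<close>

lemma even_odd_cover_extend_odd:
  assumes mp: "max_pair b P Q" and len: "Suc (length P + length Q) = 2 * card X"
    and ev: "even (length P)" and Q3: "length Q \<ge> 3"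
  shows "(\<exists>xs. mono_path b xs \<and> length xs = length P + 1) \<or>
         (\<exists>xs. mono_path (\<not> b) xs \<and> length xs = length Q + 3)"
proof (rule ccontr)
  assume no: "\<not> ?thesis"
  from even_odd_cover_ends[OF mp len ev] obtain u P' where *:
    "u \<in> X \<union> Y - set P' - set Q" "max_pair b P' Q" "length P' = length P"
    "P' \<noteq> []" "Q \<noteq> []" "side u = - side (hd Q)" "side (last Q) = side (hd Q)"
    "side (hd P') = - side (hd Q)" "side (last P') = side (hd Q)"
    "adj b u (hd Q)" "adj b u (last Q)" "odd (length Q)" .
  have P: "mono_path b P'" and Q: "mono_path (\<not> b) Q" and d: "set P' \<inter> set Q = {}"
    using *(2) by (auto simp: max_pair_def path_pair_def)
  note ends = mono_path_hd_last[OF P *(4)] mono_path_hd_last[OF Q *(5)]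
  have noP: "adj (\<not> b) z w"
    if zw: "z = hd P' \<or> z = last P'" "w \<in> X \<union> Y - set P'" "side z = - side w" for z w
  proof (rule ccontr)
    assume "\<not> ?thesis"
    hence zb: "adj b z w" using adj_opposite[of z w "\<not> b"] zw ends by auto
    have "mono_path b (w # P') \<or> mono_path b (P' @ [w])"
      using zw zb P adj_sym[of b] *(4) by (auto simp: mono_path_append)
    thus False using no *(3) by (metis length_Cons length_append_singleton Suc_eq_plus1)
  qed
  let ?x = "hd P'" and ?y = "last P'"
  have out: "?x \<notin> set Q" "hd Q \<notin> set P'" "last Q \<notin> set P'"
    using d *(4,5) by (meson disjoint_iff hd_in_set last_in_set)+
  have xq: "adj (\<not> b) ?x (hd Q)" "adj (\<not> b) ?x (last Q)"
    using noP[of ?x "hd Q"] noP[of ?x "last Q"] *(7,8) ends out by simp_all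
  have D: "mono_path (\<not> b) (?x # Q)" "adj (\<not> b) (last (?x # Q)) (hd (?x # Q))"
    using Q xq ends out *(5) adj_sym[of "\<not> b"] by simp_all
  have yu: "adj (\<not> b) ?y u" using noP[of ?y u] * by auto
  obtain q z R where QR: "Q = q # z # R" using Q3 by (auto simp: numeral_3_eq_3 Suc_le_length_iff)
  have sz: "side z = - side (hd Q)" using Q QR by (simp add: adj_iff_side)
  have zin: "z \<in> X \<union> Y - set P'" using QR Q d by auto
  have yz: "adj (\<not> b) ?y z" using noP[of ?y z] sz zin * by auto
  obtain zs where zs: "mono_path (\<not> b) zs" "set zs = set (?x # Q)" "hd zs = z" "zs \<noteq> []"
      "length zs = length (?x # Q)"
    by (rule mono_path_closed_rotate[OF D, of z]) (use QR in auto)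
  have "?y \<noteq> ?x" using * side_cases[of ?x] by auto
  moreover have "?y \<notin> set Q" using d *(4) by (meson disjoint_iff last_in_set)
  ultimately have "?y \<notin> set zs" using zs(2) by auto
  moreover have "u \<notin> set zs" "u \<noteq> ?y" using zs(2) * by auto
  ultimately have "mono_path (\<not> b) (u # ?y # zs)"
    using zs yz yu ends *(1) adj_sym by auto
  moreover have "length (u # ?y # zs) = length Q + 3" using zs by simp
  ultimately show False using no by blast
qed

text \<open>Let \<open>x, y\<^sub>1, x\<^sub>1, \<dots>, y\<close> be the even path \<open>Q\<close>, oriented to start opposite to the ends of
\<open>P\<close>, and let \<open>v\<close> be the missed vertex, joined to both ends of \<open>P\<close> in the colour of \<open>Q\<close>. Unless \<open>v\<close>
and an end of \<open>P\<close> can be put in front of \<open>Q\<close>, the path \<open>P\<close> extends by \<open>x\<close>. If \<open>P\<close> followed by \<open>x\<close>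
cannot be extended again, then its two ends, the start \<open>p\<close> of \<open>P\<close> and \<open>x\<close>, are joined to \<open>x\<^sub>1\<close> and
\<open>y\<close> in the colour of \<open>Q\<close>, and \<open>v, p, x\<^sub>1, \<dots>, y, x, y\<^sub>1\<close> is the required path.\<close>

lemma odd_even_cover_extend:
  assumes mp: "max_pair b P Q" and len: "Suc (length P + length Q) = 2 * card X"
    and odd: "odd (length P)" and Q3: "length Q \<ge> 3"
  shows "(\<exists>xs. mono_path b xs \<and> length xs = length P + 2) \<or>
         (\<exists>xs. mono_path (\<not> b) xs \<and> length xs = length Q + 2)"
proof (rule ccontr)
  assume no: "\<not> ?thesis"
  have mp': "max_pair (\<not> b) Q P" "Suc (length Q + length P) = 2 * card X" "even (length Q)"
    using mp len odd max_pair_swap by (auto simp: add.commute) presburger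
  from even_odd_cover_ends[OF mp'] obtain v Q' where *:
    "v \<in> X \<union> Y - set Q' - set P" "max_pair (\<not> b) Q' P" "length Q' = length Q"
    "Q' \<noteq> []" "P \<noteq> []" "side v = - side (hd P)" "side (last P) = side (hd P)"
    "side (hd Q') = - side (hd P)" "side (last Q') = side (hd P)"
    "adj (\<not> b) v (hd P)" "adj (\<not> b) v (last P)" "odd (length P)" .
  have P: "mono_path b P" and Q: "mono_path (\<not> b) Q'" and d: "set P \<inter> set Q' = {}"
    using *(2) by (auto simp: max_pair_def path_pair_def)
  note ends = mono_path_hd_last[OF P *(5)] mono_path_hd_last[OF Q *(4)]
  obtain x y1 x1 R where QR: "Q' = x # y1 # x1 # R"
    using Q3[folded *(3)] by (auto simp: numeral_3_eq_3 Suc_le_length_iff)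
  let ?p = "hd P" and ?p' = "last P" and ?y = "last (x1 # R)"
  have pin: "?p \<in> set P" "?p' \<in> set P" using *(5) by auto
  have xp: "adj b ?p' x"
  proof (rule ccontr)
    have "adj (\<not> b) v ?p" "adj (\<not> b) v ?p'" by (fact *)+
    assume "\<not> ?thesis"
    hence "adj (\<not> b) ?p' x" using adj_opposite[of ?p' x b] ends *(7,8) QR by auto
    hence "mono_path (\<not> b) (v # ?p' # Q')" using QR Q d *(1,11) ends pin by auto
    moreover have "length (v # ?p' # Q') = length Q + 2" using *(3) by simp
    ultimately show False using no by blast
  qed
  have xP: "x \<notin> set P" "x \<in> X \<union> Y" using d QR Q by auto
  have Px: "mono_path b (P @ [x])" using P xp xP by (auto simp: mono_path_append)
  have noP: "adj (\<not> b) z w"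
    if zw: "z = ?p \<or> z = x" "w \<in> X \<union> Y - set P - {x}" "side z = - side w" for z w
  proof (rule ccontr)
    assume "\<not> ?thesis"
    hence zb: "adj b z w" using adj_opposite[of z w "\<not> b"] zw ends xP by auto
    have "mono_path b (w # P @ [x]) \<or> mono_path b ((P @ [x]) @ [w])"
    proof (cases "z = x")
      case True
      thus ?thesis
        using zw zb Px unfolding mono_path_append[of b "P @ [x]" "[w]"] by auto
    next
      case False
      thus ?thesis using zw zb Px *(5) adj_sym[of b] by auto
    qed
    moreover have "length (w # P @ [x]) = length P + 2" "length ((P @ [x]) @ [w]) = length P + 2"
      by auto
    ultimately show False using no by blast
  qed
  have s1: "side x1 = - side ?p" using Q QR *(8) by (auto simp: adj_iff_side)
  have yin: "?y \<in> set (x1 # R)" by (metis last_in_set list.distinct(1))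
  have in1: "x1 \<in> X \<union> Y - set P - {x}" "?y \<in> X \<union> Y - set P - {x}"
    using QR Q d yin mono_path_subset[OF Q] by (auto simp: mono_path_def)
  have px: "adj (\<not> b) ?p x1" using noP[of ?p x1] s1 in1 by auto
  have "side ?y = side ?p" using *(9) QR by simp
  hence xy: "adj (\<not> b) x ?y" using noP[of x ?y] in1 *(8) QR by auto
  have R: "mono_path (\<not> b) (x1 # R)" and xy1: "adj (\<not> b) x y1" using Q QR by auto
  have "mono_path (\<not> b) [x, y1]" using Q QR by auto
  hence "mono_path (\<not> b) ((x1 # R) @ [x, y1])"
    using R xy adj_sym Q QR unfolding mono_path_append[of _ "x1 # R"] by (auto simp: mono_path_def)
  hence "mono_path (\<not> b) (v # ?p # (x1 # R) @ [x, y1])"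
    using *(1,10) px pin d QR ends by auto
  moreover have "length (v # ?p # (x1 # R) @ [x, y1]) = length Q + 2" using *(3) QR by simp
  ultimately show False using no by blast
qed

section \<open>The path-path Ramsey theorem for complete bipartite graphs\<close>

lemma complete_bipartite_path:
  assumes "A \<subseteq> X" "B \<subseteq> Y" "\<And>x y. x \<in> A \<Longrightarrow> y \<in> B \<Longrightarrow> adj b x y" "card A = Suc n" "card B = n"
  shows "\<exists>xs. mono_path b xs \<and> set xs = A \<union> B \<and> hd xs \<in> A \<and> length xs = 2 * n + 1"
  using assms
proof (induction n arbitrary: A B)
  case 0
  then obtain x where "A = {x}" by (auto simp: card_1_singleton_iff)
  moreover have "B = {}" using 0 fin finite_subset by fastforce
  ultimately show ?case using 0 by (intro exI[of _ "[x]"]) auto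
next
  case (Suc n)
  have finAB: "finite A" "finite B" using Suc.prems fin finite_subset by blast+
  obtain x y where xy: "x \<in> A" "y \<in> B" using Suc.prems by fastforce
  have "\<exists>xs. mono_path b xs \<and> set xs = (A - {x}) \<union> (B - {y}) \<and> hd xs \<in> A - {x} \<and> length xs = 2 * n + 1"
    by (rule Suc.IH) (use Suc.prems xy finAB in auto)
  then obtain xs where xs: "mono_path b xs" "set xs = (A - {x}) \<union> (B - {y})" "hd xs \<in> A - {x}"
      "length xs = 2 * n + 1" by blast
  have "x \<noteq> y" "x \<notin> B" "y \<notin> A" using xy Suc.prems disj by auto
  moreover have "adj b y (hd xs)" "adj b x y" using Suc.prems(3) xy xs(3) adj_sym by blast+
  ultimately show ?case using xs xy Suc.prems by (intro exI[of _ "x # y # xs"]) auto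
qed

lemma stuck_degree_cycles:
  assumes st: "stuck b P Q" and Y: "hd P \<in> Y"
  obtains v zs ws where "v \<in> X"
    "mono_path True zs" "length zs = 2 * card {y \<in> Y. \<not> C v y}"
    "mono_path False ws" "adj False (last ws) (hd ws)" "v \<notin> set ws"
    "set ws \<inter> Y = {y \<in> Y. C v y}" "length ws = 2 * card {y \<in> Y. C v y}"
    "card {y \<in> Y. C v y} + card {y \<in> Y. \<not> C v y} = card X"
proof -
  obtain P' Q' where st: "stuck True P' Q'" and hd: "hd P' \<in> Y" "hd Q' \<in> Y"
    using st Y stuck_swap[of b P Q] stuck_ends(1)[OF st] by (cases b) auto
  obtain v where v: "v \<in> X - set P' - set Q'" using stuck_uncovered[OF st hd(1)] by blast
  have st': "stuck False Q' P'" using st stuck_swap[of True P' Q'] by simp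
  have v': "v \<in> X - set Q' - set P'" using v by blast
  obtain zs where zs: "mono_path True zs" "length zs = 2 * card {y \<in> Y. \<not> C v y}"
    using stuck_degree_cycle[OF st hd(1) v] by auto
  obtain ws where ws: "mono_path False ws" "adj False (last ws) (hd ws)" "v \<notin> set ws"
    "set ws \<inter> Y = {y \<in> Y. C v y}" "length ws = 2 * card {y \<in> Y. C v y}"
    using stuck_degree_cycle[OF st' hd(2) v'] by auto
  have "card {y \<in> Y. C v y} + card {y \<in> Y. \<not> C v y} = card ({y \<in> Y. C v y} \<union> {y \<in> Y. \<not> C v y})"
    using fin by (intro card_Un_disjoint[symmetric]) auto
  also have "{y \<in> Y. C v y} \<union> {y \<in> Y. \<not> C v y} = Y" by blast
  finally show thesis using that v zs ws balanced by auto
qed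

lemma path_bounds:
  assumes "\<not> (\<exists>xs. mono_path b xs \<and> length xs = n)" "mono_path b xs"
  shows "length xs < n"
  using assms mono_path_shorten not_less by blast

text \<open>If both paths are too short, a maximal pair that misses at most one vertex leaves only the
lengths \<open>2s - 1\<close> or \<open>2s - 2\<close> for \<open>P\<close> and \<open>2m - 1\<close> or \<open>2m - 2\<close> for \<open>Q\<close>, because the total is at
least \<open>2s + 2m - 3\<close>. In the stuck case both degrees of \<open>v\<close> are too small to add up to
\<open>s + m - 1\<close>.\<close>

lemma even_even_paths_oriented:
  assumes card: "card X + 1 = s + m" and s: "0 < s" "0 < m"
    and mp: "max_pair True P Q" and side: "stuck True P Q \<Longrightarrow> hd P \<in> Y"
  shows "(\<exists>xs. mono_path True xs \<and> length xs = 2 * s) \<or> (\<exists>xs. mono_path False xs \<and> length xs = 2 * m)"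
proof (rule ccontr)
  assume no: "\<not> ?thesis"
  have T: "length xs < 2 * s" if "mono_path True xs" for xs using path_bounds no that by blast
  have F: "length xs < 2 * m" if "mono_path False xs" for xs using path_bounds no that by blast
  have pp: "path_pair True P Q" using mp by (simp add: max_pair_def)
  have lP: "length P < 2 * s" and lQ: "length Q < 2 * m" using T F pp by (auto simp: path_pair_def)
  have le: "length P + length Q \<le> 2 * card X" by (rule path_pair_length_le[OF pp])
  consider "stuck True P Q" | "length P + length Q = 2 * card X" | "Suc (length P + length Q) = 2 * card X"
    using le mp unfolding stuck_def by linarith
  thus False
  proof cases
    case 1
    obtain v zs ws where "mono_path True zs" "length zs = 2 * card {y \<in> Y. \<not> C v y}"
      "mono_path False ws" "length ws = 2 * card {y \<in> Y. C v y}"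
      and sum: "card {y \<in> Y. C v y} + card {y \<in> Y. \<not> C v y} = card X"
      by (rule stuck_degree_cycles[OF 1 side[OF 1]]) blast
    moreover from this have "length zs < 2 * s" "length ws < 2 * m" using T F by blast+
    ultimately have "card {y \<in> Y. \<not> C v y} < s" "card {y \<in> Y. C v y} < m" by simp_all
    thus False using sum card by linarith
  next
    case 2
    have l: "length P = 2 * s - 1" "length Q = 2 * m - 1" using 2 lP lQ card by linarith+
    hence "odd (length P)" using s by simp
    from odd_cover_exchange[OF pp 2 this] show False
      using T[of "hd Q # P"] F l s by (fastforce simp: path_pair_def)
  next
    case 3
    hence "length P = 2 * s - 2 \<and> length Q = 2 * m - 1 \<or> length P = 2 * s - 1 \<and> length Q = 2 * m - 2"
      using lP lQ card s by linarith
    thus False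
    proof
      assume l: "length P = 2 * s - 2 \<and> length Q = 2 * m - 1"
      hence "even (length P)" by simp
      from even_odd_cover_extend_even[OF mp 3 this] show False using T F l s by (fastforce split: if_splits)
    next
      assume l: "length P = 2 * s - 1 \<and> length Q = 2 * m - 2"
      have "max_pair False Q P" using mp max_pair_swap[of True P Q] by simp
      moreover have "Suc (length Q + length P) = 2 * card X" using 3 by simp
      moreover have "even (length Q)" using l by simp
      ultimately show False using even_odd_cover_extend_even[of False Q P] T F l s by (fastforce split: if_splits)
    qed
  qed
qed

text \<open>The longer path of colour \<open>True\<close> leaves more lengths to exclude. In the stuck case it
remains that \<open>v\<close> has exactly \<open>s\<close> neighbours of colour \<open>False\<close> and \<open>m - 1\<close> of colour \<open>True\<close>. A
\<open>False\<close> edge from a vertex of the \<open>False\<close> cycle to one of the former, together with \<open>v\<close>, would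
extend the cycle to a path on \<open>2m\<close> vertices. Hence these edges form a complete bipartite graph of
colour \<open>True\<close> with sides \<open>m - 1 > s\<close> and \<open>s\<close>, which contains the path on \<open>2s + 1\<close> vertices.\<close>

lemma odd_even_paths_oriented:
  assumes card: "card X + 1 = s + m" and s: "0 < s" "Suc s < m"
    and mp: "max_pair True P Q" and side: "stuck True P Q \<Longrightarrow> hd P \<in> Y"
  shows "(\<exists>xs. mono_path True xs \<and> length xs = 2 * s + 1) \<or> (\<exists>xs. mono_path False xs \<and> length xs = 2 * m)"
proof (rule ccontr)
  assume no: "\<not> ?thesis"
  have T: "length xs < 2 * s + 1" if "mono_path True xs" for xs using path_bounds no that by blast
  have F: "length xs < 2 * m" if "mono_path False xs" for xs using path_bounds no that by blast
  have pp: "path_pair True P Q" using mp by (simp add: max_pair_def)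
  have lP: "length P < 2 * s + 1" and lQ: "length Q < 2 * m" using T F pp by (auto simp: path_pair_def)
  have le: "length P + length Q \<le> 2 * card X" by (rule path_pair_length_le[OF pp])
  have even_full: False if "path_pair True P Q" "length P = 2 * s" "length Q = 2 * m - 2" for P Q
  proof -
    have "even (length P)" "even (length Q)" "P \<noteq> []" "Q \<noteq> []" using that s by auto
    from even_cover_extend[OF that(1) this] show False using T F that s by fastforce
  qed
  consider "stuck True P Q" | "length P + length Q = 2 * card X" | "Suc (length P + length Q) = 2 * card X"
    using le mp unfolding stuck_def by linarith
  thus False
  proof cases
    case 1
    obtain v zs ws where v: "v \<in> X" and zs: "mono_path True zs" "length zs = 2 * card {y \<in> Y. \<not> C v y}"
      and ws: "mono_path False ws" "adj False (last ws) (hd ws)" "v \<notin> set ws"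
      "set ws \<inter> Y = {y \<in> Y. C v y}" "length ws = 2 * card {y \<in> Y. C v y}"
      and sum: "card {y \<in> Y. C v y} + card {y \<in> Y. \<not> C v y} = card X"
      by (rule stuck_degree_cycles[OF 1 side[OF 1]]) blast
    let ?N = "{y \<in> Y. \<not> C v y}" and ?M = "{y \<in> Y. C v y}"
    have c: "card ?N = s" "card ?M = m - 1" using T[OF zs(1)] F[OF ws(1)] zs ws sum card by linarith+
    have "card (set ws \<inter> X) = m - 1"
      using mono_path_length_sides[OF ws(1)] ws c by simp
    hence "Suc s \<le> card (set ws \<inter> X)" using s by simp
    then obtain A where A: "A \<subseteq> set ws \<inter> X" "card A = Suc s" by (meson obtain_subset_with_card_n)
    have "adj True x y" if xy: "x \<in> A" "y \<in> ?N" for x y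
    proof (rule ccontr)
      assume "\<not> ?thesis"
      hence yx: "adj False y x" using xy A adj_cross(2)[of x y True] adj_sym by auto
      obtain ys where ys: "mono_path False ys" "set ys = set ws" "hd ys = x" "length ys = length ws"
        by (rule mono_path_closed_rotate[OF ws(1,2), of x]) (use xy A in auto)
      have "y \<notin> set ws" using xy ws(4) by auto
      moreover have "y \<noteq> v" using xy v disj by auto
      moreover have "adj False v y" using xy v by (simp add: adj_def)
      ultimately have "mono_path False (v # y # ys)" using ys yx v xy ws(3) by auto
      thus False using F[of "v # y # ys"] ys ws c s by simp
    qed
    hence "\<exists>xs. mono_path True xs \<and> set xs = A \<union> ?N \<and> hd xs \<in> A \<and> length xs = 2 * s + 1"
      using A c by (intro complete_bipartite_path) auto
    thus False using T by fastforce
  next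
    case 2
    hence "length P = 2 * s \<and> length Q = 2 * m - 2 \<or> length P = 2 * s - 1 \<and> length Q = 2 * m - 1"
      using lP lQ card s by linarith
    thus False
    proof
      assume "length P = 2 * s \<and> length Q = 2 * m - 2"
      thus False using even_full pp by blast
    next
      assume l: "length P = 2 * s - 1 \<and> length Q = 2 * m - 1"
      hence "odd (length P)" using s by simp
      from odd_cover_exchange[OF pp 2 this] show False
      proof
        assume pp': "path_pair True (hd Q # P) (tl Q)"
        have "length (hd Q # P) = 2 * s" "length (tl Q) = 2 * m - 2" using l s by auto
        thus False by (rule even_full[OF pp'])
      qed (use F l s in fastforce)
    qed
  next
    case 3
    hence "length P = 2 * s \<and> length Q = 2 * m - 3 \<or> length P = 2 * s - 1 \<and> length Q = 2 * m - 2 \<or>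
        length P = 2 * s - 2 \<and> length Q = 2 * m - 1"
      using lP lQ card s by linarith
    then consider "length P = 2 * s" "length Q = 2 * m - 3" | "length P = 2 * s - 1" "length Q = 2 * m - 2"
      | "length P = 2 * s - 2" "length Q = 2 * m - 1" by blast
    thus False
    proof cases
      case 1
      hence "even (length P)" "3 \<le> length Q" using s by auto
      from even_odd_cover_extend_odd[OF mp 3 this] show False using T F 1 s by fastforce
    next
      case 2
      hence "odd (length P)" "3 \<le> length Q" using s by auto
      from odd_even_cover_extend[OF mp 3 this] show False using T F 2 s by fastforce
    next
      case l: 3
      hence "even (length P)" "length Q \<noteq> 1" using s by auto
      with even_odd_cover_extend_even[OF mp 3] show False using T F l s by fastforce
    qed
  qed
qed

text \<open>The orientation of the stuck pair in the previous two lemmas is no restriction, since the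
two sides can be exchanged.\<close>

lemma bicoloured_swap: "bicoloured Y X C"
  using bicoloured_axioms by (auto simp: bicoloured_def)

lemma swap_eqs:
  "bicoloured.mono_path Y X C = mono_path"
  "bicoloured.max_pair Y X C = max_pair"
  "bicoloured.stuck Y X C = stuck"
proof -
  interpret S: bicoloured Y X C by (rule bicoloured_swap)
  have "S.adj = adj" by (auto simp: fun_eq_iff S.adj_def adj_def)
  thus 1: "S.mono_path = mono_path"
    by (simp add: fun_eq_iff S.mono_path_def mono_path_def Un_commute)
  thus "S.max_pair = max_pair"
    by (simp add: fun_eq_iff S.max_pair_def max_pair_def S.path_pair_def path_pair_def)
  thus "S.stuck = stuck"
    by (simp add: fun_eq_iff S.stuck_def stuck_def balanced)
qed

lemma stuck_hd_cases:
  assumes "stuck b P Q" "hd P \<notin> Y"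
  shows "hd P \<in> X"
proof -
  have "mono_path b P" using assms by (simp add: stuck_def max_pair_def path_pair_def)
  thus ?thesis using mono_path_hd_last[of b P] stuck_nonempty(1)[OF assms(1)] assms(2) by blast
qed

theorem even_even_paths:
  assumes "card X + 1 = s + m" "0 < s" "0 < m"
  shows "(\<exists>xs. mono_path True xs \<and> length xs = 2 * s) \<or> (\<exists>xs. mono_path False xs \<and> length xs = 2 * m)"
proof -
  interpret S: bicoloured Y X C by (rule bicoloured_swap)
  obtain P Q where mp: "max_pair True P Q" using max_pair_exists by blast
  show ?thesis
  proof (cases "stuck True P Q \<longrightarrow> hd P \<in> Y")
    case True
    thus ?thesis using even_even_paths_oriented[OF assms mp] by blast
  next
    case False
    thus ?thesis
      using S.even_even_paths_oriented[of s m P Q] assms mp stuck_hd_cases[of True P Q] balanced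
      by (simp add: swap_eqs)
  qed
qed

theorem odd_even_paths:
  assumes "card X + 1 = s + m" "0 < s" "Suc s < m"
  shows "(\<exists>xs. mono_path True xs \<and> length xs = 2 * s + 1) \<or> (\<exists>xs. mono_path False xs \<and> length xs = 2 * m)"
proof -
  interpret S: bicoloured Y X C by (rule bicoloured_swap)
  obtain P Q where mp: "max_pair True P Q" using max_pair_exists by blast
  show ?thesis
  proof (cases "stuck True P Q \<longrightarrow> hd P \<in> Y")
    case True
    thus ?thesis using odd_even_paths_oriented[OF assms mp] by blast
  next
    case False
    thus ?thesis
      using S.odd_even_paths_oriented[of s m P Q] assms mp stuck_hd_cases[of True P Q] balanced
      by (simp add: swap_eqs)
  qed
qed

end

section \<open>Copies in colour classes\<close>

lemma path_copyI:
  assumes "distinct xs" "set xs \<subseteq> {..<n}" "successively (\<lambda>x y. c {x, y} = col) xs"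
  shows "contains_copy (colour_class (complete_graph n) c col) (path_graph (length xs))"
  unfolding contains_copy_def
proof (intro exI[of _ "(!) xs"] conjI ballI)
  show "inj_on ((!) xs) (verts (path_graph (length xs)))"
    using assms(1) by (auto simp: path_graph_def inj_on_def nth_eq_iff_index_eq)
  show "(!) xs ` verts (path_graph (length xs)) \<subseteq> verts (colour_class (complete_graph n) c col)"
    using assms(2) by (auto simp: path_graph_def colour_class_def complete_graph_def subset_iff)
  fix e assume "e \<in> edges (path_graph (length xs))"
  then obtain i where i: "e = {i, Suc i}" "Suc i < length xs" by (auto simp: path_graph_def)
  have "xs ! i \<noteq> xs ! Suc i" using assms(1) i by (simp add: nth_eq_iff_index_eq)
  moreover have "xs ! i < n" "xs ! Suc i < n"
    using assms(2) i(2) by (meson Suc_lessD lessThan_iff nth_mem subsetD)+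
  moreover have "c {xs ! i, xs ! Suc i} = col"
    using assms(3) i by (simp add: successively_conv_nth)
  ultimately show "(!) xs ` e \<in> edges (colour_class (complete_graph n) c col)"
    using i by (auto simp: colour_class_def complete_graph_def nsets_def)
qed

lemma matching_copyI:
  assumes M: "matching {e \<in> [{..<n}]\<^bsup>2\<^esup>. c e = col} M" and t: "t \<le> card M"
  shows "contains_copy (colour_class (complete_graph n) c col) (matching_graph t)"
proof -
  have "{e \<in> [{..<n}]\<^bsup>2\<^esup>. c e = col} \<subseteq> [{..<n}]\<^bsup>2\<^esup>" by blast
  note card_Union_matching(1)[OF M this]
  then obtain h where h: "bij_betw h {0..<card M} M" using ex_bij_betw_nat_finite[of M] by auto
  have two: "\<exists>x y. e = {x, y} \<and> x \<noteq> y" if "e \<in> M" for e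
    using that M by (auto simp: matching_def nsets_def card_2_iff)
  have hM: "h i \<in> M" if "i < t" for i using that h t by (auto simp: bij_betw_def)
  have "\<forall>i. \<exists>x y. i < t \<longrightarrow> h i = {x, y} \<and> x \<noteq> y" using two hM by blast
  then obtain f g where fg: "\<And>i. i < t \<Longrightarrow> h i = {f i, g i} \<and> f i \<noteq> g i" by metis
  have disj: "i = j" if "i < t" "j < t" "h i \<inter> h j \<noteq> {}" for i j
  proof -
    have "h i = h j" using that hM M unfolding matching_def by blast
    thus ?thesis using that h t by (auto simp: bij_betw_def inj_on_def)
  qed
  let ?\<phi> = "\<lambda>k. if even k then f (k div 2) else g (k div 2)"
  show ?thesis
    unfolding contains_copy_def
  proof (intro exI[of _ ?\<phi>] conjI ballI)
    have mem: "?\<phi> k \<in> h (k div 2)" if "k < 2 * t" for k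
      using that fg[of "k div 2"] by auto
    show "inj_on ?\<phi> (verts (matching_graph t))"
    proof (rule inj_onI)
      fix k l assume kl: "k \<in> verts (matching_graph t)" "l \<in> verts (matching_graph t)" "?\<phi> k = ?\<phi> l"
      hence lt: "k < 2 * t" "l < 2 * t" by (auto simp: matching_graph_def)
      have "?\<phi> k \<in> h (k div 2) \<inter> h (l div 2)" using mem[OF lt(1)] mem[OF lt(2)] kl(3) by simp
      hence d: "k div 2 = l div 2" using disj[of "k div 2" "l div 2"] lt by fastforce
      have "even k = even l" using kl(3) d fg[of "l div 2"] lt by (auto split: if_splits)
      thus "k = l" using d by presburger
    qed
    show "?\<phi> ` verts (matching_graph t) \<subseteq> verts (colour_class (complete_graph n) c col)"
    proof
      fix x assume "x \<in> ?\<phi> ` verts (matching_graph t)"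
      then obtain k where k: "k < 2 * t" "x = ?\<phi> k" by (auto simp: matching_graph_def)
      have "h (k div 2) \<in> M" by (rule hM) (use k in auto)
      hence "h (k div 2) \<subseteq> {..<n}" using M by (auto simp: matching_def nsets_def)
      thus "x \<in> verts (colour_class (complete_graph n) c col)"
        using mem[OF k(1)] k(2) by (auto simp: colour_class_def complete_graph_def)
    qed
    fix e assume "e \<in> edges (matching_graph t)"
    then obtain i where i: "e = {2 * i, 2 * i + 1}" "i < t" by (auto simp: matching_graph_def)
    have "?\<phi> ` e = h i" using i fg[of i] by auto
    thus "?\<phi> ` e \<in> edges (colour_class (complete_graph n) c col)"
      using hM[OF i(2)] M by (auto simp: colour_class_def complete_graph_def matching_def)
  qed
qed

section \<open>The Ramsey numbers\<close>

lemma matching_paths_upper: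
  assumes n: "n + 1 = 2 * t + a" and at: "a \<le> t"
    and paths: "\<And>(X :: nat set) Y C. bicoloured X Y C \<Longrightarrow> card X = a \<Longrightarrow>
      (\<exists>xs. bicoloured.mono_path X Y C True xs \<and> length xs = l) \<or>
      (\<exists>xs. bicoloured.mono_path X Y C False xs \<and> length xs = l')"
    and c: "c \<in> edges (complete_graph n) \<rightarrow> {..<3}"
  shows "contains_copy (colour_class (complete_graph n) c 0) (matching_graph t) \<or>
         contains_copy (colour_class (complete_graph n) c 1) (path_graph l) \<or>
         contains_copy (colour_class (complete_graph n) c 2) (path_graph l')"
proof (rule ccontr)
  assume no: "\<not> ?thesis"
  let ?E = "{e \<in> [{..<n}]\<^bsup>2\<^esup>. c e = 0}"
  have "card M < t" if "matching ?E M" for M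
    using matching_copyI[OF that] no by (meson not_less)
  then obtain A B where AB: "A \<subseteq> {..<n}" "B \<subseteq> {..<n}" "A \<inter> B = {}" "card A = a" "card B = a"
      and nored: "\<forall>x\<in>A. \<forall>y\<in>B. {x, y} \<notin> ?E"
    using no_matching_imp_empty_bipartite[of "{..<n}" ?E t a] n at by auto
  have cross: "c {x, y} = 1 \<or> c {x, y} = 2" if xy: "x \<in> A" "y \<in> B" for x y
  proof -
    have "x \<noteq> y" using xy AB by blast
    hence "{x, y} \<in> [{..<n}]\<^bsup>2\<^esup>" using xy AB by (auto simp: nsets_def)
    moreover from this have "c {x, y} < 3" using c by (auto simp: complete_graph_def)
    ultimately show ?thesis using nored xy by fastforce
  qed
  define C where "C = (\<lambda>x y. c {x, y} = 1)"
  have "finite A" "finite B" using AB(1,2) by (auto intro: finite_subset)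
  then interpret bicoloured A B C
    by unfold_locales (use AB in \<open>auto simp: C_def insert_commute\<close>)
  have colour: "c {x, y} = (if b then 1 else 2)" if "adj b x y" for b x y
    using that cross[of x y] cross[of y x] unfolding adj_def
    by (auto simp: C_def insert_commute)
  have copy: "contains_copy (colour_class (complete_graph n) c (if b then 1 else 2)) (path_graph (length xs))"
    if xs: "mono_path b xs" for b xs
  proof (rule path_copyI)
    show "distinct xs" "set xs \<subseteq> {..<n}" using xs AB by (auto simp: mono_path_def)
    show "successively (\<lambda>x y. c {x, y} = (if b then 1 else 2)) xs"
      using xs colour by (auto simp: mono_path_def intro: successively_mono)
  qed
  show False
    using paths[OF bicoloured_axioms AB(4)] copy[of True] copy[of False] no by auto
qed

text \<open>A path on \<open>2k\<close> vertices contains \<open>k\<close> disjoint edges, each of which needs its own vertex of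
the cover.\<close>

lemma vertex_cover_path_copy:
  assumes copy: "contains_copy (colour_class H c i) (path_graph l)" and "2 * k \<le> l" and "finite A"
    and cover: "\<And>e. e \<in> edges H \<Longrightarrow> c e = i \<Longrightarrow> e \<inter> A \<noteq> {}"
  shows "k \<le> card A"
proof -
  obtain \<phi> where \<phi>: "inj_on \<phi> (verts (path_graph l))"
    "\<And>e. e \<in> edges (path_graph l) \<Longrightarrow> \<phi> ` e \<in> edges (colour_class H c i)"
    using copy unfolding contains_copy_def by blast
  have inj: "inj_on \<phi> {..<l}" using \<phi>(1) by (simp add: path_graph_def)
  have edge: "\<phi> ` {j, Suc j} \<in> edges H \<and> c (\<phi> ` {j, Suc j}) = i" if "Suc j < l" for j
  proof -
    have "{j, Suc j} \<in> edges (path_graph l)" using that by (auto simp: path_graph_def)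
    thus ?thesis using \<phi>(2) unfolding colour_class_def by fastforce
  qed
  have "\<forall>j. \<exists>x. j < k \<longrightarrow> x \<in> {2 * j, Suc (2 * j)} \<and> \<phi> x \<in> A"
  proof (intro allI)
    fix j
    have "\<phi> ` {2 * j, Suc (2 * j)} \<inter> A \<noteq> {}" if "j < k"
      by (rule cover) (use edge[of "2 * j"] that assms(2) in auto)
    thus "\<exists>x. j < k \<longrightarrow> x \<in> {2 * j, Suc (2 * j)} \<and> \<phi> x \<in> A" by blast
  qed
  then obtain f where f: "\<And>j. j < k \<Longrightarrow> f j \<in> {2 * j, Suc (2 * j)} \<and> \<phi> (f j) \<in> A" by metis
  have div: "f j div 2 = j" if "j < k" for j using f[OF that] by auto
  have "inj_on (\<lambda>j. \<phi> (f j)) {..<k}"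
  proof (rule inj_onI)
    fix j j' assume j: "j \<in> {..<k}" "j' \<in> {..<k}" "\<phi> (f j) = \<phi> (f j')"
    have "f j < l" "f j' < l" using f[of j] f[of j'] j assms(2) by auto
    hence "f j = f j'" using inj j by (auto simp: inj_on_def)
    thus "j = j'" using div j by (metis lessThan_iff)
  qed
  moreover have "(\<lambda>j. \<phi> (f j)) ` {..<k} \<subseteq> A" using f by auto
  ultimately show ?thesis using card_inj_on_le[of _ "{..<k}" A] assms(3) by fastforce
qed

lemma matching_copy_vertices:
  assumes copy: "contains_copy (colour_class H c i) (matching_graph t)" and "finite B"
    and cover: "\<And>e. e \<in> edges H \<Longrightarrow> c e = i \<Longrightarrow> e \<subseteq> B"
  shows "2 * t \<le> card B"
proof -
  obtain \<phi> where \<phi>: "inj_on \<phi> (verts (matching_graph t))"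
    "\<And>e. e \<in> edges (matching_graph t) \<Longrightarrow> \<phi> ` e \<in> edges (colour_class H c i)"
    using copy unfolding contains_copy_def by blast
  have inj: "inj_on \<phi> {..<2 * t}" using \<phi>(1) by (simp add: matching_graph_def)
  have edge: "\<phi> ` {2 * j, 2 * j + 1} \<in> edges H \<and> c (\<phi> ` {2 * j, 2 * j + 1}) = i" if "j < t" for j
  proof -
    have "{2 * j, 2 * j + 1} \<in> edges (matching_graph t)" using that by (auto simp: matching_graph_def)
    thus ?thesis using \<phi>(2) unfolding colour_class_def by fastforce
  qed
  have "\<phi> k \<in> B" if "k < 2 * t" for k
  proof -
    have "\<phi> ` {2 * (k div 2), 2 * (k div 2) + 1} \<subseteq> B"
      by (rule cover) (use edge[of "k div 2"] that in auto)
    moreover have "k = 2 * (k div 2) \<or> k = 2 * (k div 2) + 1" by presburger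
    ultimately show ?thesis by (metis image_subset_iff insertCI)
  qed
  thus ?thesis using card_inj_on_le[OF inj, of B] assms(2) by auto
qed

lemma matching_paths_lower:
  assumes pos: "0 < s" "0 < m" "0 < t" and n: "n < s + m + 2 * t - 2" and l: "2 * s \<le> l" "2 * m \<le> l'"
  obtains c where "c \<in> edges (complete_graph n) \<rightarrow> {..<3}"
    "\<not> contains_copy (colour_class (complete_graph n) c 0) (matching_graph t)"
    "\<not> contains_copy (colour_class (complete_graph n) c 1) (path_graph l)"
    "\<not> contains_copy (colour_class (complete_graph n) c 2) (path_graph l')"
proof
  define c :: "nat set \<Rightarrow> nat" where
    "c e = (if e \<inter> {..<s - 1} \<noteq> {} then 1 else if e \<inter> {s - 1..<s + m - 2} \<noteq> {} then 2 else 0)" for e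
  show "c \<in> edges (complete_graph n) \<rightarrow> {..<3}" by (auto simp: c_def)
  show "\<not> contains_copy (colour_class (complete_graph n) c 0) (matching_graph t)"
  proof
    assume copy: "contains_copy (colour_class (complete_graph n) c 0) (matching_graph t)"
    have "e \<subseteq> {s + m - 2..<n}" if e: "e \<in> edges (complete_graph n)" "c e = 0" for e
    proof
      fix x assume x: "x \<in> e"
      hence "x < n" using e by (auto simp: complete_graph_def nsets_def)
      moreover have "x \<notin> {..<s - 1}" "x \<notin> {s - 1..<s + m - 2}"
        using e(2) x by (auto simp: c_def split: if_splits)
      ultimately show "x \<in> {s + m - 2..<n}" by auto
    qed
    hence "2 * t \<le> card {s + m - 2..<n}" by (intro matching_copy_vertices[OF copy]) auto
    thus False using n pos by simp
  qed
  show "\<not> contains_copy (colour_class (complete_graph n) c 1) (path_graph l)"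
  proof
    assume copy: "contains_copy (colour_class (complete_graph n) c 1) (path_graph l)"
    have "s \<le> card {..<s - 1}"
    proof (rule vertex_cover_path_copy[OF copy l(1)])
      fix e :: "nat set" assume "c e = 1"
      thus "e \<inter> {..<s - 1} \<noteq> {}" by (cases "e \<inter> {..<s - 1} = {}") (simp_all add: c_def split: if_split_asm)
    qed simp
    thus False using pos by simp
  qed
  show "\<not> contains_copy (colour_class (complete_graph n) c 2) (path_graph l')"
  proof
    assume copy: "contains_copy (colour_class (complete_graph n) c 2) (path_graph l')"
    have "m \<le> card {s - 1..<s + m - 2}"
    proof (rule vertex_cover_path_copy[OF copy l(2)])
      fix e :: "nat set" assume "c e = 2"
      thus "e \<inter> {s - 1..<s + m - 2} \<noteq> {}"
        by (cases "e \<inter> {s - 1..<s + m - 2} = {}") (simp_all add: c_def split: if_split_asm)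
    qed simp
    thus False using pos by simp
  qed
qed

lemma ramsey_matching_paths:
  assumes pos: "0 < s" "0 < m" "0 < t" and t: "s + m - 1 \<le> t"
    and l: "2 * s \<le> l" "2 * m \<le> l'"
    and paths: "\<And>(X :: nat set) Y C. bicoloured X Y C \<Longrightarrow> card X = s + m - 1 \<Longrightarrow>
      (\<exists>xs. bicoloured.mono_path X Y C True xs \<and> length xs = l) \<or>
      (\<exists>xs. bicoloured.mono_path X Y C False xs \<and> length xs = l')"
  shows "ramsey_number [matching_graph t, path_graph l, path_graph l'] = s + m + 2 * t - 2"
  unfolding ramsey_number_def
proof (rule Least_equality)
  let ?Gs = "[matching_graph t, path_graph l, path_graph l']"
  have all3: "(\<exists>i<3. contains_copy (colour_class (complete_graph n) c i) (?Gs ! i)) \<longleftrightarrow>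
      contains_copy (colour_class (complete_graph n) c 0) (matching_graph t) \<or>
      contains_copy (colour_class (complete_graph n) c 1) (path_graph l) \<or>
      contains_copy (colour_class (complete_graph n) c 2) (path_graph l')" for n c
    by (auto simp: Ex_less_Suc numeral_3_eq_3 numeral_2_eq_2)
  have len: "length ?Gs = 3" by simp
  show "\<forall>c\<in>edges (complete_graph (s + m + 2 * t - 2)) \<rightarrow> {..<length ?Gs}.
      \<exists>i<length ?Gs. contains_copy (colour_class (complete_graph (s + m + 2 * t - 2)) c i) (?Gs ! i)"
    unfolding len all3
    using matching_paths_upper[OF _ t paths, of "s + m + 2 * t - 2"] pos by simp
  fix n assume good: "\<forall>c\<in>edges (complete_graph n) \<rightarrow> {..<length ?Gs}.
      \<exists>i<length ?Gs. contains_copy (colour_class (complete_graph n) c i) (?Gs ! i)"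
  show "s + m + 2 * t - 2 \<le> n"
  proof (rule ccontr)
    assume "\<not> ?thesis"
    hence "n < s + m + 2 * t - 2" by simp
    from matching_paths_lower[OF pos this l] good show False
      unfolding len all3 by metis
  qed
qed

theorem theorem11:
  fixes k m s t :: nat
  assumes "k > 0" "m > 0" "s > 0" "t > 0"
  shows "(even k \<longrightarrow>
            ramsey_number [matching_graph (k - 1), path_graph k, path_graph k] = 3 * k - 4) \<and>
         (s < m - 1 \<and> m - 1 < 2 * s + 1 \<and> t \<ge> m + s - 1 \<longrightarrow>
            ramsey_number [matching_graph t, path_graph (2 * s + 1), path_graph (2 * m)]
              = s + m + 2 * t - 2)"
proof (intro conjI impI)
  assume "even k"
  then obtain r where k: "k = 2 * r" by (elim evenE)
  hence r: "0 < r" "0 < k - 1" using assms(1) by auto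
  have "ramsey_number [matching_graph (k - 1), path_graph k, path_graph k] = r + r + 2 * (k - 1) - 2"
  proof (rule ramsey_matching_paths)
    fix X Y :: "nat set" and C
    assume "bicoloured X Y C" and card: "card X = r + r - 1"
    then interpret bicoloured X Y C by simp
    show "(\<exists>xs. mono_path True xs \<and> length xs = k) \<or> (\<exists>xs. mono_path False xs \<and> length xs = k)"
      using even_even_paths[of r r] card r k by simp
  qed (use r k in auto)
  thus "ramsey_number [matching_graph (k - 1), path_graph k, path_graph k] = 3 * k - 4"
    using k by simp
next
  assume A: "s < m - 1 \<and> m - 1 < 2 * s + 1 \<and> t \<ge> m + s - 1"
  show "ramsey_number [matching_graph t, path_graph (2 * s + 1), path_graph (2 * m)] = s + m + 2 * t - 2"
  proof (rule ramsey_matching_paths)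
    fix X Y :: "nat set" and C
    assume "bicoloured X Y C" and card: "card X = s + m - 1"
    then interpret bicoloured X Y C by simp
    show "(\<exists>xs. mono_path True xs \<and> length xs = 2 * s + 1) \<or> (\<exists>xs. mono_path False xs \<and> length xs = 2 * m)"
      by (rule odd_even_paths) (use card A assms in auto)
  qed (use A assms in auto)
qed

end
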